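(* Let $X=(X_t)_{t\in[0,1]}$ be a real-valued $(\nu,\sigma^2,b)$-Lévy process with $\sigma\neq0$. Then, as $\varepsilon\to0$, $$-\log\mathbb{P}(\|X\|\le\varepsilon)\sim\frac{\pi^2}{8}\sigma^2\varepsilon^{-2}.$$
   Context: $\|X\|:=\sup_{t\in[0,1]}|X_t|$, and $f\sim g$ means $\lim f/g=1$. A $(\nu,\sigma^2,b)$-Lévy process $X=(X_t)_{t\in[0,1]}$ is a process with independent stationary increments, $X_0=0$, stochastic continuity and càdlàg paths such that $\mathbb{E}e^{iuX_t}=e^{-t\psi(u)}$ with $$\psi(u)=\frac{\sigma^2}{2}u^2-ibu+\int_{\mathbb{R}\setminus\{0\}}\left(1-e^{iux}+\mathbf 1_{\{|x|\le1\}}iux\right)\nu(dx),$$ where $\sigma^2\in[0,\infty)$, $b\in\mathbb{R}$ and $\nu$ (the Lévy measure) is a positive measure on $\mathbb{R}\setminus\{0\}$ with $\int 1\wedge x^2\,\nu(dx)<\infty$. *)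

theory Defs
  imports "HOL-Probability.Probability" "HOL-Library.Landau_Symbols"
begin

text \<open>Levy measures live on the punctured line, so the origin is not even in their space.\<close>

definition levy_measure :: "real measure \<Rightarrow> bool" where
  "levy_measure \<nu> \<longleftrightarrow>
     sets \<nu> = sets (restrict_space borel (UNIV - {0})) \<and>
     (\<integral>\<^sup>+x. ennreal (min 1 (x\<^sup>2)) \<partial>\<nu>) < \<infinity>"

text \<open>The second argument of \<open>levy_exponent\<close> (and the fourth of \<open>levy_process\<close> below)
  is the variance \<open>\<sigma>\<^sup>2\<close>, not \<open>\<sigma>\<close>.\<close>

definition levy_exponent :: "real measure \<Rightarrow> real \<Rightarrow> real \<Rightarrow> real \<Rightarrow> complex" where
  "levy_exponent \<nu> v b u =
     of_real (v / 2 * u\<^sup>2) - \<i> * of_real (b * u) +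
     (CLINT x|\<nu>. 1 - iexp (u * x) + indicator {x. \<bar>x\<bar> \<le> 1} x * (\<i> * of_real (u * x)))"

definition cadlag_on_unit :: "(real \<Rightarrow> real) \<Rightarrow> bool" where
  "cadlag_on_unit f \<longleftrightarrow>
     (\<forall>t\<in>{0..<1}. continuous (at_right t) f) \<and>
     (\<forall>t\<in>{0<..1}. \<exists>l. (f \<longlongrightarrow> l) (at_left t))"

text \<open>Only the values \<open>X t\<close> with \<open>t \<in> {0..1}\<close> are constrained; every path (rather than
  almost every path) is cadlag.\<close>

locale levy_process = prob_space M
  for M :: "'a measure" and X :: "real \<Rightarrow> 'a \<Rightarrow> real"
    and \<nu> :: "real measure" and v :: real and b :: real +
  assumes levy_measure: "levy_measure \<nu>"
    and variance_nonneg: "0 \<le> v"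
    and random_variable: "\<And>t. t \<in> {0..1} \<Longrightarrow> random_variable borel (X t)"
    and start: "AE \<omega> in M. X 0 \<omega> = 0"
    and independent_increments:
      "\<And>(n::nat) (t :: nat \<Rightarrow> real). 0 \<le> t 0 \<Longrightarrow> t n \<le> 1 \<Longrightarrow> (\<And>i. i < n \<Longrightarrow> t i \<le> t (Suc i)) \<Longrightarrow>
         indep_vars (\<lambda>_. borel) (\<lambda>i \<omega>. X (t (Suc i)) \<omega> - X (t i) \<omega>) {..<n}"
    and stationary_increments:
      "\<And>s h. 0 \<le> s \<Longrightarrow> 0 \<le> h \<Longrightarrow> s + h \<le> 1 \<Longrightarrow>
         distr M borel (\<lambda>\<omega>. X (s + h) \<omega> - X s \<omega>) = distr M borel (\<lambda>\<omega>. X h \<omega> - X 0 \<omega>)"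
    and stochastically_continuous:
      "\<And>t e. t \<in> {0..1} \<Longrightarrow> 0 < e \<Longrightarrow>
         ((\<lambda>s. prob {\<omega> \<in> space M. \<bar>X s \<omega> - X t \<omega>\<bar> > e}) \<longlongrightarrow> 0) (at t within {0..1})"
    and cadlag_paths: "\<And>\<omega>. \<omega> \<in> space M \<Longrightarrow> cadlag_on_unit (\<lambda>t. X t \<omega>)"
    and characteristic_function:
      "\<And>t u. t \<in> {0..1} \<Longrightarrow>
         char (distr M borel (X t)) u = exp (- (of_real t * levy_exponent \<nu> v b u))"

text \<open>The supremum is a genuine one for cadlag paths, which are bounded on \<open>{0..1}\<close>.\<close>

definition path_sup_norm :: "(real \<Rightarrow> 'a \<Rightarrow> real) \<Rightarrow> 'a \<Rightarrow> real" where
  "path_sup_norm X \<omega> = (SUP t\<in>{0..1}. \<bar>X t \<omega>\<bar>)"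

end

theory Submission
  imports Defs
begin

text \<open>Write \<open>\<psi>\<close> for the exponent of the process. As \<open>\<epsilon> \<rightarrow> 0\<close>, the rescaled exponent \<open>\<epsilon>\<^sup>2 \<psi> (u / \<epsilon>)\<close>
  tends to \<open>\<sigma>\<^sup>2 u\<^sup>2 / 2\<close> uniformly on compact sets, so \<open>X / \<epsilon>\<close>, observed on a grid, is a random walk
  whose step has almost Gaussian characteristic function, and
  the question is how fast this walk, killed outside \<open>[-1, 1]\<close>, loses mass. Since
  \<open>E cos (a (x + Y)) = Re (exp (i a x) E exp (i a Y))\<close>, cosines are almost eigenfunctions of the
  step. For \<open>a < \<pi> / 2\<close>, \<open>cos (a x)\<close> is bounded below on \<open>[-1, 1]\<close> and yields the upper bound
  \<open>exp (- \<sigma>\<^sup>2 a\<^sup>2 / (2 \<epsilon>\<^sup>2))\<close> for the probability up to a constant. For \<open>a > \<pi> / 2\<close> and small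
  \<open>\<kappa> > 0\<close>, the positive part of \<open>cos (a x) + \<kappa>\<close> near the origin yields the matching lower bound:
  the constant \<open>\<kappa>\<close> does not decay under the step, and this gain, linear in the time step, absorbs all errors.
  The errors come from large steps and from excursions between
  coarse grid points; Ottaviani's inequality reduces them to the tail of one increment, which is
  of smaller order than the time step.\<close>

section \<open>Random walks killed outside the unit interval\<close>

definition bounded_borel :: "(real \<Rightarrow> real) \<Rightarrow> bool" where
  "bounded_borel f \<longleftrightarrow> f \<in> borel_measurable borel \<and> (\<exists>B. \<forall>x. \<bar>f x\<bar> \<le> B)"

lemma bounded_borel_measurable [measurable_dest]: "bounded_borel f \<Longrightarrow> f \<in> borel_measurable borel"
  by (simp add: bounded_borel_def)

lemma bounded_borelI:
  "f \<in> borel_measurable borel \<Longrightarrow> (\<And>x. \<bar>f x\<bar> \<le> B) \<Longrightarrow> bounded_borel f"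
  by (auto simp: bounded_borel_def)

lemma bounded_borel_scale: "bounded_borel f \<Longrightarrow> bounded_borel (\<lambda>x. c * f x)"
proof -
  assume "bounded_borel f"
  then obtain B where "\<And>x. \<bar>f x\<bar> \<le> B" and "f \<in> borel_measurable borel"
    by (auto simp: bounded_borel_def)
  then show ?thesis
    by (intro bounded_borelI[where B = "\<bar>c\<bar> * B"]) (auto simp: abs_mult mult_left_mono)
qed

section \<open>Convolution powers, the laws of partial sums\<close>

lemma integral_convolution:
  fixes f :: "real \<Rightarrow> 'b :: {banach, second_countable_topology}"
  assumes "real_distribution M" "real_distribution N"
    and [measurable]: "f \<in> borel_measurable borel" and bound: "\<And>x. norm (f x) \<le> B"
  shows "(\<integral>z. f z \<partial>(M \<star> N)) = (\<integral>x. (\<integral>y. f (x + y) \<partial>N) \<partial>M)"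
proof -
  interpret M: real_distribution M by fact
  interpret N: real_distribution N by fact
  interpret MN: pair_prob_space M N ..
  have "integrable (M \<Otimes>\<^sub>M N) (\<lambda>p. f (fst p + snd p))"
    by (rule MN.integrable_const_bound[of _ B]) (auto simp: bound)
  from MN.integral_fst'[OF this] show ?thesis
    unfolding convolution_def by (simp add: integral_distr case_prod_unfold)
qed

lemma real_distribution_convolution:
  assumes "real_distribution M" "real_distribution N"
  shows "real_distribution (M \<star> N)"
proof -
  interpret M: real_distribution M by fact
  interpret N: real_distribution N by fact
  interpret MN: pair_prob_space M N ..
  show ?thesis
    unfolding convolution_def by (intro MN.real_distribution_distr) simp
qed

lemma char_convolution:
  assumes "real_distribution M" "real_distribution N"
  shows "char (M \<star> N) u = char M u * char N u"
proof -
  have "char (M \<star> N) u = (CLINT x|M. CLINT y|N. iexp (u * (x + y)))"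
    unfolding char_def using assms by (intro integral_convolution[where B = 1]) auto
  also have "\<dots> = (CLINT x|M. CLINT y|N. iexp (u * x) * iexp (u * y))"
    by (simp add: distrib_left exp_add)
  finally show ?thesis by (simp add: char_def)
qed

definition convolution_power :: "real measure \<Rightarrow> nat \<Rightarrow> real measure" where
  "convolution_power M n = ((\<star>) M ^^ n) (return borel 0)"

lemma convolution_power_0 [simp]: "convolution_power M 0 = return borel 0"
  and convolution_power_Suc [simp]:
    "convolution_power M (Suc n) = (M \<star> convolution_power M n)"
  by (simp_all add: convolution_power_def)

text \<open>The barrier is tested at the current position, before the step. Hence in
  \<open>(kill M ^^ n) f 0\<close> the walk is tested at times 0 to n - 1, and its position at time
  n is seen only by \<open>f\<close>; taking \<open>f\<close> to be the indicator of
  \<open>{-1..1}\<close> adds the last test.\<close>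

definition kill :: "real measure \<Rightarrow> (real \<Rightarrow> real) \<Rightarrow> real \<Rightarrow> real" where
  "kill M f x = (if \<bar>x\<bar> \<le> 1 then \<integral>y. f (x + y) \<partial>M else 0)"

text \<open>The probability that a walk started at \<open>x\<close> is outside
  \<open>{-\<rho>..\<rho>}\<close> at some time from 0 to \<open>n\<close>; the recursion conditions
  on the first step.\<close>

primrec exit_prob :: "real measure \<Rightarrow> real \<Rightarrow> nat \<Rightarrow> real \<Rightarrow> real" where
  "exit_prob M \<rho> 0 x = (if \<bar>x\<bar> > \<rho> then 1 else 0)"
| "exit_prob M \<rho> (Suc n) x = (if \<bar>x\<bar> > \<rho> then 1 else \<integral>y. exit_prob M \<rho> n (x + y) \<partial>M)"

context real_distribution
begin

lemma real_distribution_power: "real_distribution (convolution_power M n)"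
proof (induction n)
  case 0
  then show ?case
    by (auto simp: real_distribution_def real_distribution_axioms_def intro: prob_space_return)
next
  case (Suc n)
  then show ?case by (simp add: real_distribution_convolution real_distribution_axioms)
qed

lemma char_convolution_power: "char (convolution_power M n) u = char M u ^ n"
proof (induction n)
  case 0
  then show ?case by (simp add: char_def integral_return)
next
  case (Suc n)
  then show ?case
    by (simp add: char_convolution real_distribution_axioms real_distribution_power)
qed

section \<open>Bounded functions, monotonicity and scaling under the killed step\<close>

lemma integrable_bounded_borel:
  assumes "bounded_borel f"
  shows "integrable M (\<lambda>y. f (x + y))"
proof -
  obtain B where "\<And>x. \<bar>f x\<bar> \<le> B" and [measurable]: "f \<in> borel_measurable borel"
    using assms by (auto simp: bounded_borel_def)
  then show ?thesis by (intro integrable_const_bound[of _ B]) auto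
qed

lemma bounded_borel_integral:
  assumes "bounded_borel f"
  shows "bounded_borel (\<lambda>x. \<integral>y. f (x + y) \<partial>M)"
proof -
  obtain B where B: "\<And>x. \<bar>f x\<bar> \<le> B" and [measurable]: "f \<in> borel_measurable borel"
    using assms by (auto simp: bounded_borel_def)
  have "\<bar>\<integral>y. f (x + y) \<partial>M\<bar> \<le> B" for x
    using integrable_bounded_borel[OF assms] B
    by (intro order.trans[OF integral_abs_bound] integral_le_const) auto
  then show ?thesis by (intro bounded_borelI[of _ B]) auto
qed

lemma bounded_borel_kill: "bounded_borel f \<Longrightarrow> bounded_borel (kill M f)"
proof -
  assume "bounded_borel f"
  from bounded_borel_integral[OF this] obtain B
    where B: "\<And>x. \<bar>\<integral>y. f (x + y) \<partial>M\<bar> \<le> B"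
      and [measurable]: "(\<lambda>x. \<integral>y. f (x + y) \<partial>M) \<in> borel_measurable borel"
    by (auto simp: bounded_borel_def)
  have "kill M f = (\<lambda>x. if \<bar>x\<bar> \<le> 1 then \<integral>y. f (x + y) \<partial>M else 0)"
    by (auto simp: kill_def)
  moreover have "0 \<le> B" using B[of 0] by linarith
  ultimately show ?thesis using B by (intro bounded_borelI[of _ B]) auto
qed

lemma bounded_borel_kill_pow: "bounded_borel f \<Longrightarrow> bounded_borel ((kill M ^^ n) f)"
  by (induction n) (auto intro: bounded_borel_kill)

lemma kill_mono:
  assumes "bounded_borel f" "bounded_borel g" "\<And>x. f x \<le> g x"
  shows "kill M f x \<le> kill M g x"
  using assms by (auto simp: kill_def intro!: integral_mono integrable_bounded_borel)

lemma kill_pow_mono: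
  assumes "bounded_borel f" "bounded_borel g" "\<And>x. f x \<le> g x"
  shows "(kill M ^^ n) f x \<le> (kill M ^^ n) g x"
  using assms
  by (induction n arbitrary: x) (auto intro!: kill_mono bounded_borel_kill_pow)

lemma kill_scale: "kill M (\<lambda>x. c * f x) = (\<lambda>x. c * kill M f x)"
  by (auto simp: kill_def)

lemma kill_pow_scale: "(kill M ^^ n) (\<lambda>x. c * f x) = (\<lambda>x. c * (kill M ^^ n) f x)"
  by (induction n) (auto simp: kill_scale)

lemma bounded_borel_exit_prob:
  "bounded_borel (exit_prob M \<rho> n) \<and> (\<forall>x. 0 \<le> exit_prob M \<rho> n x \<and> exit_prob M \<rho> n x \<le> 1)"
proof (induction n)
  case 0
  have "exit_prob M \<rho> 0 = (\<lambda>x. if \<bar>x\<bar> > \<rho> then 1 else 0)" by auto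
  then show ?case by (auto intro!: bounded_borelI[of _ 1])
next
  case (Suc n)
  have int: "integrable M (\<lambda>y. exit_prob M \<rho> n (x + y))" for x
    using Suc integrable_bounded_borel by blast
  have b: "0 \<le> exit_prob M \<rho> (Suc n) x \<and> exit_prob M \<rho> (Suc n) x \<le> 1" for x
    using Suc int[of x] by (auto intro!: integral_nonneg_AE integral_le_const)
  have [measurable]: "(\<lambda>x. \<integral>y. exit_prob M \<rho> n (x + y) \<partial>M) \<in> borel_measurable borel"
    using bounded_borel_integral Suc by (auto simp: bounded_borel_def)
  have "exit_prob M \<rho> (Suc n) = (\<lambda>x. if \<bar>x\<bar> > \<rho> then 1 else \<integral>y. exit_prob M \<rho> n (x + y) \<partial>M)"
    by auto
  moreover have "\<dots> \<in> borel_measurable borel" by measurable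
  ultimately have "exit_prob M \<rho> (Suc n) \<in> borel_measurable borel" by simp
  then have "bounded_borel (exit_prob M \<rho> (Suc n))"
    by (rule bounded_borelI[where B = 1]) (use b in \<open>auto simp del: exit_prob.simps\<close>)
  with b show ?case by blast
qed

text \<open>Ottaviani's inequality.\<close>

lemma exit_prob_le_tail:
  assumes tail: "\<And>i. i \<le> n \<Longrightarrow> measure (convolution_power M i) {y. \<bar>y\<bar> \<ge> \<eta>} \<le> 1 / 2"
  shows "exit_prob M (2 * \<eta>) n x \<le> 2 * measure (convolution_power M n) {y. \<bar>x + y\<bar> \<ge> \<eta>}"
  using tail
proof (induction n arbitrary: x)
  case 0
  then show ?case by (cases "\<eta> \<le> 0") (auto simp: measure_return indicator_def)
next
  case (Suc n)
  define P where "P = convolution_power M (Suc n)"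
  interpret P: real_distribution P unfolding P_def by (rule real_distribution_power)
  interpret N: real_distribution "convolution_power M n" by (rule real_distribution_power)
  show ?case
  proof (cases "\<bar>x\<bar> > 2 * \<eta>")
    case True
    \<comment> \<open>From a point beyond \<open>2 * \<eta>\<close> only a move of size at least
      \<open>\<eta>\<close> can lead back within \<open>\<eta>\<close> of the origin, and this has
      probability at most 1/2; hence the factor 2 in the claim.\<close>
    have "UNIV - {y. \<bar>y\<bar> \<ge> \<eta>} \<subseteq> {y. \<bar>x + y\<bar> \<ge> \<eta>}" using True by auto
    then have "1 - measure P {y. \<bar>y\<bar> \<ge> \<eta>} \<le> measure P {y. \<bar>x + y\<bar> \<ge> \<eta>}"
      by (subst P.prob_compl[symmetric]) (auto intro!: P.finite_measure_mono)
    with Suc.prems[of "Suc n"] True show ?thesis by (simp add: P_def)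
  next
    case False
    \<comment> \<open>Conditioning on the first step gives the tail the same recursion as
      \<open>exit_prob\<close>, so the induction hypothesis can be integrated.\<close>
    have eq: "measure (convolution_power M (Suc n)) {y. \<bar>x + y\<bar> \<ge> \<eta>}
        = (\<integral>y. measure (convolution_power M n) {z. \<bar>x + y + z\<bar> \<ge> \<eta>} \<partial>M)"
    proof -
      have "measure P {y. \<bar>x + y\<bar> \<ge> \<eta>} = (\<integral>z. indicator {y. \<bar>x + y\<bar> \<ge> \<eta>} z \<partial>P)" by simp
      also have "\<dots> = (\<integral>y. (\<integral>z. indicator {y. \<bar>x + y\<bar> \<ge> \<eta>} (y + z) \<partial>convolution_power M n) \<partial>M)"
        unfolding P_def convolution_power_Suc
        by (rule integral_convolution[where B = 1])
          (auto simp: real_distribution_axioms N.real_distribution_axioms)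
      also have "\<dots> = (\<integral>y. (\<integral>z. indicator {z. \<bar>x + y + z\<bar> \<ge> \<eta>} z \<partial>convolution_power M n) \<partial>M)"
        by (intro Bochner_Integration.integral_cong refl) (auto simp: indicator_def algebra_simps)
      finally show ?thesis by (simp add: P_def)
    qed
    have [measurable]: "(\<lambda>y. measure (convolution_power M n) {z. \<bar>x + y + z\<bar> \<ge> \<eta>}) \<in> borel_measurable borel"
    proof -
      have "(\<lambda>y. \<integral>z. (indicator {z. \<bar>x + z\<bar> \<ge> \<eta>} (y + z) :: real) \<partial>convolution_power M n) \<in> borel_measurable borel"
        by (rule bounded_borel_measurable, rule N.bounded_borel_integral)
          (auto intro!: bounded_borelI[where B = 1])
      moreover have "(\<integral>z. (indicator {z. \<bar>x + z\<bar> \<ge> \<eta>} (y + z) :: real) \<partial>convolution_power M n)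
         = measure (convolution_power M n) {z. \<bar>x + y + z\<bar> \<ge> \<eta>}" for y
      proof -
        have "(\<integral>z. (indicator {z. \<bar>x + z\<bar> \<ge> \<eta>} (y + z) :: real) \<partial>convolution_power M n)
          = (\<integral>z. indicator {z. \<bar>x + y + z\<bar> \<ge> \<eta>} z \<partial>convolution_power M n)"
          by (intro Bochner_Integration.integral_cong refl) (auto simp: indicator_def algebra_simps)
        then show ?thesis by simp
      qed
      ultimately show ?thesis by simp
    qed
    have "exit_prob M (2 * \<eta>) (Suc n) x = (\<integral>y. exit_prob M (2 * \<eta>) n (x + y) \<partial>M)"
      using False by simp
    also have "\<dots> \<le> (\<integral>y. 2 * measure (convolution_power M n) {z. \<bar>x + y + z\<bar> \<ge> \<eta>} \<partial>M)"
      by (intro integral_mono integrable_bounded_borel integrable_const_bound[of _ 2] Suc)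
        (auto simp: bounded_borel_exit_prob)
    finally show ?thesis by (simp only: eq integral_mult_right_zero)
  qed
qed

end

section \<open>Exponential bounds by trigonometric test functions\<close>

text \<open>With \<open>z\<close> the characteristic function of a step and \<open>e\<close> the
  intended eigenvalue, this measures, uniformly in the position, how far the cosine is from being an
  eigenfunction.\<close>

lemma Re_iexp_mult_bounds:
  "\<bar>Re (iexp t * z) - cos t * e\<bar> \<le> cmod (z - of_real e)"
proof -
  have "Re (iexp t * z) - cos t * e = Re (iexp t * (z - of_real e))"
    by (simp add: Re_exp Im_exp algebra_simps)
  also have "\<bar>\<dots>\<bar> \<le> cmod (iexp t * (z - of_real e))" by (rule abs_Re_le_cmod)
  finally show ?thesis by (simp add: norm_mult)
qed

section \<open>Exponentials and cosines as test functions for the killed walk\<close>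

context real_distribution
begin

lemma integrable_cos_translate: "integrable M (\<lambda>y. cos (a * (x + y)))"
  by (rule integrable_const_bound[of _ 1]) auto

text \<open>The complex exponential is an exact eigenfunction of the step because it is
  multiplicative. The factor \<open>c\<close> leaves room for powers of \<open>char M a\<close>
  collected over several steps.\<close>

lemma integral_iexp_translate:
  "(CLINT y|M. iexp (a * (x + y)) * c) = iexp (a * x) * char M a * c"
  and integrable_iexp_translate: "integrable M (\<lambda>y. iexp (a * (x + y)) * c)"
proof -
  have "(CLINT y|M. iexp (a * (x + y)) * c) = (CLINT y|M. (iexp (a * x) * c) * iexp (a * y))"
    by (simp add: distrib_left exp_add mult_ac)
  also have "\<dots> = iexp (a * x) * char M a * c" by (simp add: char_def)
  finally show "(CLINT y|M. iexp (a * (x + y)) * c) = iexp (a * x) * char M a * c" .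
  show "integrable M (\<lambda>y. iexp (a * (x + y)) * c)"
    by (rule integrable_const_bound[of _ "norm c"]) (auto simp: norm_mult)
qed

lemma integral_cos_translate:
  "(\<integral>y. cos (a * (x + y)) \<partial>M) = Re (iexp (a * x) * char M a)"
proof -
  have "(\<integral>y. cos (a * (x + y)) \<partial>M) = (\<integral>y. Re (iexp (a * (x + y)) * 1) \<partial>M)"
    by (simp add: Re_exp)
  also have "\<dots> = Re (CLINT y|M. iexp (a * (x + y)) * 1)"
    by (rule integral_Re[OF integrable_iexp_translate])
  also have "\<dots> = Re (iexp (a * x) * char M a * 1)"
    by (simp only: integral_iexp_translate)
  finally show ?thesis by simp
qed

text \<open>The cosine cut off outside \<open>{-1..1}\<close> is a supersolution with factor
  \<open>q\<close>. Before the cut it is at least \<open>cos a\<close> on \<open>{-1..1}\<close> and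
  positive up to \<open>pi / (2 * a) > 1\<close>, so cutting it off can do harm only after a step of
  size at least \<open>pi / (2 * a) - 1\<close>. The slack \<open>cos a * (q - e)\<close> pays for
  such steps and for the eigenvalue error.\<close>

lemma kill_pow_upper:
  assumes a: "0 < a" "a < pi / 2"
    and q: "cmod (char M a - of_real e) + measure M {y. \<bar>y\<bar> \<ge> pi / (2 * a) - 1} \<le> cos a * (q - e)"
  shows "(kill M ^^ n) (indicator {-1..1}) 0 \<le> q ^ n / cos a"
proof -
  define \<phi> where "\<phi> x = cos (a * x) * indicator {-1..1::real} x" for x
  define p where "p = measure M {y. \<bar>y\<bar> \<ge> pi / (2 * a) - 1}"
  have ca: "0 < cos a" using a by (intro cos_gt_zero) auto
  have "bounded_borel \<phi>" unfolding \<phi>_def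
    by (rule bounded_borelI[of _ 1]) (auto simp: indicator_def)
  have cos_ge: "cos a \<le> cos (a * x)" if "\<bar>x\<bar> \<le> 1" for x
  proof -
    have "cos (a * x) = cos (a * \<bar>x\<bar>)" by (auto simp: abs_if)
    moreover have "a * \<bar>x\<bar> \<le> a * 1" using that a by (intro mult_left_mono) auto
    ultimately show ?thesis using a cos_monotone_0_pi_le[of "a * \<bar>x\<bar>" a] by simp
  qed
  have "0 \<le> p" by (simp add: p_def)
  with q have "0 \<le> cos a * (q - e)" by (smt (verit) norm_ge_zero p_def)
  with ca have "e \<le> q" by (simp add: zero_le_mult_iff)
  have step: "kill M \<phi> x \<le> q * \<phi> x" for x
  proof (cases "\<bar>x\<bar> \<le> 1")
    case True
    have pt: "\<phi> (x + y) \<le> cos (a * (x + y)) + indicator {y. \<bar>y\<bar> \<ge> pi / (2 * a) - 1} y" for y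
    proof (cases "\<bar>x + y\<bar> \<le> 1 \<or> \<bar>y\<bar> \<ge> pi / (2 * a) - 1")
      case True
      moreover have "0 \<le> cos (a * (x + y)) + 1"
        using cos_ge_minus_one[of "a * (x + y)"] by linarith
      ultimately show ?thesis using cos_ge[of "x + y"] ca
        by (auto simp: \<phi>_def indicator_def abs_le_iff)
    next
      case False
      then have "\<bar>x + y\<bar> < pi / (2 * a)" using True by linarith
      then have "a * \<bar>x + y\<bar> < pi / 2" using a by (simp add: field_simps)
      then have "\<bar>a * (x + y)\<bar> < pi / 2" using a by (simp only: abs_mult abs_of_pos)
      then have "0 < cos (a * (x + y))" by (intro cos_gt_zero_pi) auto
      then show ?thesis using False by (auto simp: \<phi>_def indicator_def abs_le_iff)
    qed
    have "kill M \<phi> x = (\<integral>y. \<phi> (x + y) \<partial>M)" using True by (simp add: kill_def)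
    also have "\<dots> \<le> (\<integral>y. cos (a * (x + y)) + indicator {y. \<bar>y\<bar> \<ge> pi / (2 * a) - 1} y \<partial>M)"
      by (intro integral_mono integrable_bounded_borel \<open>bounded_borel \<phi>\<close>
          Bochner_Integration.integrable_add integrable_cos_translate pt)
        (auto intro!: integrable_const_bound[of _ 1])
    also have "\<dots> = Re (iexp (a * x) * char M a) + p"
    proof (subst Bochner_Integration.integral_add)
      show "integrable M (indicator {y. \<bar>y\<bar> \<ge> pi / (2 * a) - 1} :: real \<Rightarrow> real)"
        by (auto intro!: integrable_const_bound[of _ 1])
    qed (simp_all add: integrable_cos_translate integral_cos_translate p_def)
    also have "\<dots> \<le> cos (a * x) * e + cos a * (q - e)"
      using q Re_iexp_mult_bounds[of "a * x" "char M a" e] by (simp add: p_def)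
    also have "\<dots> \<le> cos (a * x) * e + cos (a * x) * (q - e)"
      using cos_ge[OF True] \<open>e \<le> q\<close> by (intro add_left_mono mult_right_mono) auto
    also have "\<dots> = q * \<phi> x" using True by (auto simp: \<phi>_def algebra_simps indicator_def)
    finally show ?thesis .
  qed (auto simp: kill_def \<phi>_def indicator_def)
  \<comment> \<open>The sign of \<open>q\<close> is read off from the step inequality at 0, where
    \<open>\<phi>\<close> equals 1; the iteration below multiplies inequalities by powers of
    \<open>q\<close>.\<close>
  have q0: "0 \<le> q"
  proof -
    have "0 \<le> kill M \<phi> 0"
    proof -
      have "0 \<le> \<phi> y" for y using cos_ge[of y] ca by (auto simp: \<phi>_def indicator_def abs_le_iff)
      then show ?thesis by (auto simp: kill_def intro!: integral_nonneg_AE)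
    qed
    with step[of 0] show ?thesis by (simp add: \<phi>_def)
  qed
  have pow: "(kill M ^^ n) \<phi> x \<le> q ^ n * \<phi> x" for x
  proof (induction n arbitrary: x)
    case (Suc n)
    have "(kill M ^^ Suc n) \<phi> x \<le> kill M (\<lambda>x. q ^ n * \<phi> x) x"
      using Suc bounded_borel_kill_pow[OF \<open>bounded_borel \<phi>\<close>]
      by (auto intro!: kill_mono bounded_borel_scale \<open>bounded_borel \<phi>\<close>)
    also have "\<dots> \<le> q ^ n * (q * \<phi> x)"
      by (auto simp: kill_scale intro!: mult_left_mono step zero_le_power q0)
    finally show ?case by (simp add: mult_ac)
  qed simp
  have "indicator {-1..1} x \<le> (1 / cos a) * \<phi> x" for x
    using cos_ge[of x] ca by (auto simp: \<phi>_def indicator_def abs_le_iff divide_simps)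
  then have "(kill M ^^ n) (indicator {-1..1}) 0 \<le> (kill M ^^ n) (\<lambda>x. (1 / cos a) * \<phi> x) 0"
    by (intro kill_pow_mono bounded_borel_scale \<open>bounded_borel \<phi>\<close>) 
      (auto intro!: bounded_borelI[of _ 1] simp: indicator_def)
  also have "\<dots> = (1 / cos a) * (kill M ^^ n) \<phi> 0" by (simp only: kill_pow_scale)
  also have "\<dots> \<le> (1 / cos a) * (q ^ n * \<phi> 0)" using pow[of 0] ca by (intro mult_left_mono) auto
  finally show ?thesis by (simp add: \<phi>_def)
qed

text \<open>A subsolution argument over blocks of \<open>m\<close> steps, with a raised cosine cut
  off outside \<open>{-r..r}\<close>. From there the walk leaves \<open>{-1..1}\<close> within a
  block only if it moves by more than \<open>1 - r\<close>, and Ottaviani's inequality bounds this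
  through the law of the whole block.\<close>

lemma kill_pow_lower:
  assumes a: "pi / 2 < a" "a \<le> pi" and r: "pi / 2 < a * r" "r < 1" and e: "0 \<le> e"
    and tail: "\<And>i. i \<le> m \<Longrightarrow> measure (convolution_power M i) {y. \<bar>y\<bar> \<ge> (1 - r) / 2} \<le> 1 / 2"
    and gain: "cmod (char M a ^ m - of_real e)
      + 4 * measure (convolution_power M m) {y. \<bar>y\<bar> \<ge> (1 - r) / 2} \<le> - cos (a * r) * (1 - e)"
  shows "e ^ n \<le> (kill M ^^ (n * m)) (indicator {-1..1}) 0"
proof -
  \<comment> \<open>With this value the raised cosine vanishes at \<open>r\<close>, and
    \<open>a \<le> pi\<close> makes it nonpositive between \<open>r\<close> and 1. On
    \<open>{-1..1}\<close> the function \<open>\<phi>\<close> is therefore exactly its positive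
    part.\<close>
  define \<kappa> where "\<kappa> = - cos (a * r)"
  define \<phi> where "\<phi> x = (if \<bar>x\<bar> \<le> r then cos (a * x) + \<kappa> else 0)" for x
  have "r > 0" using r a pi_gt_zero by (smt (verit) zero_less_mult_iff pi_half_gt_zero)
  have "0 < a" using a pi_half_gt_zero by linarith
  have "a * r < a * 1" using r \<open>0 < a\<close> by (intro mult_strict_left_mono) auto
  then have ar: "a * r < pi" using a by linarith
  have \<kappa>: "0 < \<kappa>" "\<kappa> \<le> 1"
  proof -
    have "cos (a * r) < cos (pi / 2)" using r ar by (intro cos_monotone_0_pi) auto
    then show "0 < \<kappa>" "\<kappa> \<le> 1" using cos_ge_minus_one[of "a * r"] by (auto simp: \<kappa>_def)
  qed
  have cos_abs: "cos (a * x) = cos (a * \<bar>x\<bar>)" for x by (auto simp: abs_if)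
  have \<phi>_nonneg: "0 \<le> \<phi> x" for x
  proof (cases "\<bar>x\<bar> \<le> r")
    case True
    then have "a * \<bar>x\<bar> \<le> a * r" using \<open>0 < a\<close> by (intro mult_left_mono) auto
    then have "cos (a * r) \<le> cos (a * \<bar>x\<bar>)" using ar \<open>0 < a\<close> by (intro cos_monotone_0_pi_le) auto
    then show ?thesis by (auto simp: \<phi>_def \<kappa>_def cos_abs[of x])
  qed (simp add: \<phi>_def)
  have \<phi>_ge: "cos (a * x) + \<kappa> \<le> \<phi> x" if "\<bar>x\<bar> \<le> 1" for x
  proof (cases "\<bar>x\<bar> \<le> r")
    case False
    have "a * r \<le> a * \<bar>x\<bar>" "a * \<bar>x\<bar> \<le> a * 1" using that \<open>0 < a\<close> False by (intro mult_left_mono; simp)+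
    moreover from this have "a * \<bar>x\<bar> \<le> pi" using a by linarith
    ultimately have "cos (a * \<bar>x\<bar>) \<le> cos (a * r)"
      using \<open>0 < a\<close> \<open>0 < r\<close> by (intro cos_monotone_0_pi_le) auto
    then show ?thesis using False by (simp add: \<phi>_def \<kappa>_def cos_abs[of x])
  qed (simp add: \<phi>_def)
  have \<phi>_le: "\<phi> x \<le> 1 + \<kappa>" for x using \<kappa> by (auto simp: \<phi>_def)
  have bb: "bounded_borel \<phi>"
  proof (rule bounded_borelI[of _ "1 + \<kappa>"])
    show "\<phi> \<in> borel_measurable borel" unfolding \<phi>_def by measurable
  qed (use \<phi>_nonneg \<phi>_le in auto)
  have nonneg: "0 \<le> (kill M ^^ j) \<phi> x" for j x
  proof (induction j arbitrary: x)
    case (Suc j)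
    then show ?case by (auto simp: kill_def intro!: integral_nonneg_AE)
  qed (simp add: \<phi>_nonneg)
  \<comment> \<open>Induction on the number of remaining steps, with the starting point
    \<open>x0\<close> of the block fixed. While the displacement \<open>x - x0\<close> is at most
    \<open>1 - r\<close> in size, the walk is in \<open>{-1..1}\<close> and killing has no effect;
    beyond that, \<open>exit_prob\<close> is 1 and the left side is at most 0.\<close>
  have block: "Re (iexp (a * x) * char M a ^ j) + \<kappa> - (1 + \<kappa>) * exit_prob M (1 - r) j (x - x0)
      \<le> (kill M ^^ j) \<phi> x" if x0: "\<bar>x0\<bar> \<le> r" for x0 x j
  proof (induction j arbitrary: x)
    case 0
    show ?case
    proof (cases "\<bar>x - x0\<bar> > 1 - r")
      case True
      then show ?thesis using \<phi>_nonneg[of x] by (simp add: Re_exp) (smt (verit) cos_le_one)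
    next
      case False
      then have "\<bar>x\<bar> \<le> 1" using x0 by linarith
      then show ?thesis using \<phi>_ge[of x] False by (simp add: Re_exp)
    qed
  next
    case (Suc j)
    show ?case
    proof (cases "\<bar>x - x0\<bar> > 1 - r")
      case True
      have "Re (iexp (a * x) * char M a ^ Suc j) \<le> cmod (iexp (a * x) * char M a ^ Suc j)"
        by (rule complex_Re_le_cmod)
      also have "\<dots> \<le> 1" unfolding norm_mult norm_power
        using cmod_char_le_1[of a] power_le_one[of "cmod (char M a)" "Suc j"] by simp
      finally show ?thesis using nonneg[of "Suc j" x] True by (simp del: power_Suc funpow.simps)
    next
      case False
      then have x: "\<bar>x\<bar> \<le> 1" using x0 by linarith
      have ex: "bounded_borel (exit_prob M (1 - r) j)" using bounded_borel_exit_prob by blast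
      have iex: "integrable M (\<lambda>y. exit_prob M (1 - r) j (x + y - x0))"
        using integrable_bounded_borel[OF ex, of "x - x0"] by (simp add: algebra_simps)
      have ire: "integrable M (\<lambda>y. Re (iexp (a * (x + y)) * char M a ^ j))"
        by (intro integrable_Re integrable_iexp_translate)
      have "Re (iexp (a * x) * char M a ^ Suc j) + \<kappa> - (1 + \<kappa>) * exit_prob M (1 - r) (Suc j) (x - x0)
        = Re (CLINT y|M. iexp (a * (x + y)) * char M a ^ j) + \<kappa>
           - (1 + \<kappa>) * (\<integral>y. exit_prob M (1 - r) j (x + y - x0) \<partial>M)"
      proof -
        have "iexp (a * x) * char M a ^ Suc j = (CLINT y|M. iexp (a * (x + y)) * char M a ^ j)"
          by (simp only: integral_iexp_translate power_Suc mult.assoc)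
        moreover have "exit_prob M (1 - r) (Suc j) (x - x0) = (\<integral>y. exit_prob M (1 - r) j (x + y - x0) \<partial>M)"
          using False by (simp add: algebra_simps)
        ultimately show ?thesis by (simp only:)
      qed
      also have "\<dots> = (\<integral>y. Re (iexp (a * (x + y)) * char M a ^ j) + \<kappa>
           - (1 + \<kappa>) * exit_prob M (1 - r) j (x + y - x0) \<partial>M)"
      proof -
        define F where "F y = iexp (a * (x + y)) * char M a ^ j" for y
        have "integrable M F" unfolding F_def by (rule integrable_iexp_translate)
        moreover have "prob UNIV = 1" using prob_space by simp
        ultimately show ?thesis using iex unfolding F_def[symmetric] by (simp add: integral_Re)
      qed
      also have "\<dots> \<le> (\<integral>y. (kill M ^^ j) \<phi> (x + y) \<partial>M)"
      proof (rule integral_mono)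
        show "integrable M (\<lambda>y. Re (iexp (a * (x + y)) * char M a ^ j) + \<kappa>
           - (1 + \<kappa>) * exit_prob M (1 - r) j (x + y - x0))"
          by (intro Bochner_Integration.integrable_diff Bochner_Integration.integrable_add
              ire integrable_mult_right iex) simp
        show "integrable M (\<lambda>y. (kill M ^^ j) \<phi> (x + y))"
          by (intro integrable_bounded_borel bounded_borel_kill_pow bb)
      qed (rule Suc)
      also have "\<dots> = (kill M ^^ Suc j) \<phi> x" using x by (simp add: kill_def)
      finally show ?thesis .
    qed
  qed
  \<comment> \<open>The eigenfunction part of \<open>cos (a x) + \<kappa>\<close> decays by \<open>e\<close>, the constant does not:
    this leaves \<open>\<kappa> (1 - e)\<close> to pay for the errors, even where \<open>\<phi>\<close> vanishes.\<close>
  have step: "e * \<phi> x \<le> (kill M ^^ m) \<phi> x" for x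
  proof (cases "\<bar>x\<bar> \<le> r")
    case True
    define p where "p = measure (convolution_power M m) {y. \<bar>y\<bar> \<ge> (1 - r) / 2}"
    have "exit_prob M (1 - r) m 0 \<le> 2 * p"
    proof -
      have eq: "2 * ((1 - r) / 2) = 1 - r" by simp
      have "exit_prob M (2 * ((1 - r) / 2)) m 0
          \<le> 2 * measure (convolution_power M m) {y. \<bar>0 + y\<bar> \<ge> (1 - r) / 2}"
        by (rule exit_prob_le_tail) (rule tail)
      then show ?thesis unfolding eq p_def by simp
    qed
    \<comment> \<open>The bound \<open>1 + \<kappa> \<le> 2\<close> and the 2 in Ottaviani's
      inequality make up the 4 in \<open>gain\<close>.\<close>
    then have "(1 + \<kappa>) * exit_prob M (1 - r) m 0 \<le> 2 * (2 * p)"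
      using \<kappa> bounded_borel_exit_prob[of "1 - r" m] by (intro mult_mono) auto
    moreover have "cos (a * x) * e - cmod (char M a ^ m - of_real e) \<le> Re (iexp (a * x) * char M a ^ m)"
      using Re_iexp_mult_bounds[of "a * x" "char M a ^ m" e] by linarith
    ultimately have "e * \<phi> x \<le> Re (iexp (a * x) * char M a ^ m) + \<kappa> - (1 + \<kappa>) * exit_prob M (1 - r) m (x - x)"
      using gain True by (simp add: \<phi>_def p_def \<kappa>_def algebra_simps)
    also have "\<dots> \<le> (kill M ^^ m) \<phi> x" by (rule block[OF True])
    finally show ?thesis .
  qed (auto simp: \<phi>_def nonneg)
  have pow: "e ^ n * \<phi> x \<le> (kill M ^^ (n * m)) \<phi> x" for x
  proof (induction n arbitrary: x)
    case (Suc n)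
    have "e ^ Suc n * \<phi> x \<le> e ^ n * (kill M ^^ m) \<phi> x"
      using mult_left_mono[OF step[of x], of "e ^ n"] e by (simp add: mult_ac)
    also have "\<dots> = (kill M ^^ m) (\<lambda>x. e ^ n * \<phi> x) x" by (simp add: kill_pow_scale)
    also have "\<dots> \<le> (kill M ^^ m) ((kill M ^^ (n * m)) \<phi>) x"
      by (intro kill_pow_mono bounded_borel_scale bounded_borel_kill_pow bb Suc)
    finally show ?case by (simp add: funpow_add)
  qed simp
  \<comment> \<open>Since \<open>1 + \<kappa>\<close> is both an upper bound of
    \<open>\<phi>\<close> and its value at the starting point 0, it cancels and the final estimate
    carries no constant.\<close>
  have "\<phi> x \<le> (1 + \<kappa>) * indicator {-1..1} x" for x
    using \<phi>_le[of x] r by (auto simp: \<phi>_def indicator_def)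
  then have "(kill M ^^ (n * m)) \<phi> 0 \<le> (kill M ^^ (n * m)) (\<lambda>x. (1 + \<kappa>) * indicator {-1..1} x) 0"
    by (intro kill_pow_mono bb bounded_borel_scale)
      (auto intro!: bounded_borelI[of _ 1] simp: indicator_def)
  also have "\<dots> = (1 + \<kappa>) * (kill M ^^ (n * m)) (indicator {-1..1}) 0"
    by (simp add: kill_pow_scale)
  finally have "(1 + \<kappa>) * e ^ n \<le> (1 + \<kappa>) * (kill M ^^ (n * m)) (indicator {-1..1}) 0"
    using pow[of 0] \<open>0 < r\<close> by (simp add: \<phi>_def mult_ac)
  then show ?thesis using \<kappa> by simp
qed

end

section \<open>Tails from characteristic functions\<close>

lemma integral_cos_0:
  fixes y U :: real
  assumes "y \<noteq> 0" "0 \<le> U"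
  shows "integral\<^sup>L (restrict_space lborel {0..U}) (\<lambda>u. cos (u * y)) = sin (U * y) / y"
proof -
  have "integral\<^sup>L (restrict_space lborel {0..U}) (\<lambda>u. cos (u * y))
      = (\<integral>u. indicator {0..U} u *\<^sub>R cos (u * y) \<partial>lborel)"
    by (subst integral_restrict_space) auto
  also have "\<dots> = sin (U * y) / y - sin (0 * y) / y"
    by (rule integral_FTC_Icc[OF assms(2)])
      (use assms in \<open>auto intro!: derivative_eq_intros continuous_intros
        simp: has_real_derivative_iff_has_vector_derivative[symmetric]\<close>)
  finally show ?thesis by simp
qed

text \<open>The integrand in the hypothesis is \<open>E (1 - cos (u Y))\<^sup>2\<close>. Unlike \<open>E (1 - cos (u Y))\<close>, it is of
  second order in \<open>s\<close> when \<open>char M u = exp (- s u\<^sup>2)\<close>; averaging over \<open>u\<close> makes it detect the tail.\<close>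

lemma (in real_distribution) tail_le_char:
  assumes \<eta>: "0 < \<eta>" and B: "\<And>u. 0 \<le> u \<Longrightarrow> u \<le> 3 / \<eta> \<Longrightarrow>
    3 / 2 - 2 * Re (char M u) + Re (char M (2 * u)) / 2 \<le> B"
  shows "measure M {y. \<bar>y\<bar> \<ge> \<eta>} \<le> 2 * B"
proof -
  \<comment> \<open>For \<bar>y\<bar> \<ge> \<eta> this makes the integrals of the two cosines at
    most U / 3 and U / 6 in size, so the integral of \<open>w\<close> over \<open>{0..U}\<close> is
    at least 3 U / 4; the weaker U / 2 is what is used.\<close>
  define U where "U = 3 / \<eta>"
  define L where "L = restrict_space lborel {0..U}"
  define w where "w u y = 3 / 2 - 2 * cos (u * y) + cos (2 * u * y) / 2" for u y :: real
  have "0 < U" using \<eta> by (simp add: U_def)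
  interpret L: finite_measure L
    using \<open>0 < U\<close> by (auto simp: L_def emeasure_restrict_space intro!: finite_measureI)
  interpret P: pair_sigma_finite M L ..
  interpret PF: finite_measure "M \<Otimes>\<^sub>M L"
    by (rule finite_measure_pair_measure) unfold_locales
  have mL: "measure L (space L) = U"
    using \<open>0 < U\<close> by (simp add: L_def measure_restrict_space)
  have [measurable_cong]: "sets L = sets (restrict_space borel {0..U})"
    by (simp add: L_def sets_restrict_space)
  have w_sq: "w u y = (1 - cos (u * y))\<^sup>2" for u y
    using cos_double_cos[of "u * y"] by (simp add: w_def power2_eq_square algebra_simps)
  have w_le: "\<bar>w u y\<bar> \<le> 4" for u y
    using abs_cos_le_one[of "u * y"] power_mono[of "1 - cos (u * y)" 2 2] by (simp add: w_sq)
  have [measurable]: "(\<lambda>(y, u). w u y) \<in> borel_measurable (M \<Otimes>\<^sub>M L)"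
  proof -
    have "(\<lambda>(y, u). w u y) \<in> borel_measurable (borel \<Otimes>\<^sub>M borel)"
      unfolding w_def by measurable
    moreover have "(\<lambda>p. (fst p, snd p)) \<in> (M \<Otimes>\<^sub>M L) \<rightarrow>\<^sub>M (borel \<Otimes>\<^sub>M borel)"
      by (intro measurable_Pair measurable_compose[OF measurable_snd])
        (auto simp: L_def intro: measurable_restrict_space1)
    ultimately show ?thesis by (auto dest: measurable_compose[rotated])
  qed
  have int: "integrable (M \<Otimes>\<^sub>M L) (\<lambda>(y, u). w u y)"
    by (rule PF.integrable_const_bound[of _ 4]) (auto simp: w_le)
  have icos: "integrable L (\<lambda>u. cos (c * u * y))" for c y :: real
    by (rule L.integrable_const_bound[of _ 1]) (auto simp: L_def intro: measurable_restrict_space1)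
  have lower: "U / 2 * indicator {y. \<bar>y\<bar> \<ge> \<eta>} y \<le> (\<integral>u. w u y \<partial>L)" for y
  proof (cases "\<bar>y\<bar> \<ge> \<eta>")
    case True
    then have "y \<noteq> 0" using \<eta> by auto
    have "(\<integral>u. w u y \<partial>L) = 3 / 2 * U - 2 * (\<integral>u. cos (u * y) \<partial>L) + (\<integral>u. cos (u * (2 * y)) \<partial>L) / 2"
      using icos[of 1 y] icos[of 2 y] mL by (simp add: w_def mult_ac)
    also have "\<dots> = 3 / 2 * U - 2 * (sin (U * y) / y) + (sin (U * (2 * y)) / (2 * y)) / 2"
      using \<open>y \<noteq> 0\<close> \<open>0 < U\<close> unfolding L_def by (simp add: integral_cos_0)
    finally have eq: "(\<integral>u. w u y \<partial>L) = \<dots>" .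
    have "\<bar>sin (U * y) / y\<bar> \<le> 1 / \<eta>" "\<bar>sin (U * (2 * y)) / (2 * y)\<bar> \<le> 1 / (2 * \<eta>)"
      using True \<eta> unfolding abs_divide by (intro frac_le; simp)+
    moreover have "U = 3 * (1 / \<eta>)" "1 / (2 * \<eta>) = (1 / \<eta>) / 2" "0 < 1 / \<eta>"
      using \<eta> by (auto simp: U_def)
    moreover have "x / 2 \<le> 3 / 2 * x - 2 * c + d / 2"
      if "\<bar>c\<bar> \<le> t" "\<bar>d\<bar> \<le> t / 2" "x = 3 * t" "0 < t" for c d t x :: real
      using that by linarith
    ultimately have "U / 2 \<le> 3 / 2 * U - 2 * (sin (U * y) / y) + (sin (U * (2 * y)) / (2 * y)) / 2"
      by metis
    then show ?thesis unfolding eq using True by simp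
  next
    case False
    then show ?thesis by (auto simp: w_sq intro!: integral_nonneg_AE)
  qed
  have char_cos: "(\<integral>y. cos (u * y) \<partial>M) = Re (char M u)" for u
    using integral_cos_translate[of u 0] by simp
  have upper: "(\<integral>y. w u y \<partial>M) \<le> B" if "u \<in> space L" for u
  proof -
    have "(\<integral>y. w u y \<partial>M) = 3 / 2 - 2 * Re (char M u) + Re (char M (2 * u)) / 2"
      using integrable_cos_translate[of u 0] integrable_cos_translate[of "2 * u" 0]
      using prob_space by (simp add: w_def char_cos[symmetric] mult_ac)
    also have "\<dots> \<le> B" using that by (intro B) (auto simp: L_def U_def space_restrict_space)
    finally show ?thesis .
  qed
  have "U / 2 * measure M {y. \<bar>y\<bar> \<ge> \<eta>} = (\<integral>y. U / 2 * indicator {y. \<bar>y\<bar> \<ge> \<eta>} y \<partial>M)" by simp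
  also have "\<dots> \<le> (\<integral>y. (\<integral>u. w u y \<partial>L) \<partial>M)"
    using P.integrable_fst[OF int] lower
    by (intro integral_mono) (auto intro!: integrable_const_bound[of _ "U / 2"] simp: indicator_def \<open>0 < U\<close> less_imp_le)
  also have "\<dots> = (\<integral>u. (\<integral>y. w u y \<partial>M) \<partial>L)" using P.Fubini_integral[OF int] by simp
  also have "\<dots> \<le> (\<integral>u. B \<partial>L)"
    using P.integrable_snd[OF int] upper by (intro integral_mono) auto
  also have "\<dots> = U * B" using mL by simp
  finally show ?thesis using \<open>0 < U\<close> by (simp add: field_simps)
qed

section \<open>Short-time expansion when the exponent is nearly Gaussian\<close>

lemma cmod_exp_minus_linear:
  assumes "cmod z \<le> 1"
  shows "cmod (exp (- z) - (1 - z)) \<le> 3 * (cmod z)\<^sup>2"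
proof -
  have "cmod (exp (- z) - (\<Sum>i\<le>1. (- z) ^ i / fact i)) \<le> exp \<bar>Re (- z)\<bar> * cmod (- z) ^ Suc 1 / fact 1"
    by (rule Taylor_exp)
  also have "\<dots> \<le> 3 * (cmod z)\<^sup>2"
  proof -
    have "\<bar>Re (- z)\<bar> \<le> 1" using abs_Re_le_cmod[of z] assms by simp
    then have "exp \<bar>Re (- z)\<bar> \<le> exp 1" by simp
    also have "exp 1 \<le> (3::real)" by (rule exp_le)
    finally show ?thesis by (simp add: power2_eq_square mult_right_mono)
  qed
  finally show ?thesis by simp
qed

text \<open>The combination of \<open>char M u\<close> and \<open>char M (2 * u)\<close> in
  \<open>tail_le_char\<close> cancels the quadratic part of the exponent. To first order in
  \<open>s\<close> only the deviation \<open>\<theta>\<close> from the Gaussian exponent remains,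
  and the rest is of order s^2. Doubled frequencies up to \<open>2 * (3 / \<eta>)\<close> occur,
  hence the window \<open>6 / \<eta>\<close>.\<close>

lemma (in real_distribution) tail_le_exponent:
  assumes \<eta>: "0 < \<eta>" and s: "0 \<le> s"
    and char: "\<And>u. char M u = exp (- (of_real s * \<psi> u))"
    and \<psi>: "\<And>u. 0 \<le> u \<Longrightarrow> u \<le> 6 / \<eta> \<Longrightarrow> cmod (\<psi> u - of_real (v / 2 * u\<^sup>2)) \<le> \<theta>"
    and D: "v / 2 * (6 / \<eta>)\<^sup>2 + \<theta> \<le> D" "s * D \<le> 1" and v: "0 \<le> v"
  shows "measure M {y. \<bar>y\<bar> \<ge> \<eta>} \<le> 6 * (s * \<theta>) + 16 * (s * D)\<^sup>2"
proof -
  have z_le: "cmod (of_real s * \<psi> u) \<le> s * D" if "0 \<le> u" "u \<le> 6 / \<eta>" for u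
  proof -
    have "cmod (\<psi> u) \<le> cmod (of_real (v / 2 * u\<^sup>2)) + \<theta>"
      using \<psi>[OF that] norm_triangle_sub[of "\<psi> u" "of_real (v / 2 * u\<^sup>2)"] by linarith
    also have "cmod (of_real (v / 2 * u\<^sup>2)) = v / 2 * u\<^sup>2" using v unfolding norm_of_real by simp
    also have "v / 2 * u\<^sup>2 \<le> v / 2 * (6 / \<eta>)\<^sup>2"
      using that v by (intro mult_left_mono power_mono) auto
    finally show ?thesis using D s by (simp add: norm_mult mult_left_mono)
  qed
  have Re_exp_le: "\<bar>Re (exp (- z)) - (1 - Re z)\<bar> \<le> 3 * (s * D)\<^sup>2" if "cmod z \<le> s * D" for z
  proof -
    have "\<bar>Re (exp (- z) - (1 - z))\<bar> \<le> cmod (exp (- z) - (1 - z))" by (rule abs_Re_le_cmod)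
    also have "\<dots> \<le> 3 * (cmod z)\<^sup>2" using that D by (intro cmod_exp_minus_linear) linarith
    also have "\<dots> \<le> 3 * (s * D)\<^sup>2" using that by (intro mult_left_mono power_mono) auto
    finally show ?thesis by simp
  qed
  \<comment> \<open>The 3 rounds up 2 + 1/2, the weights of the two values of the exponent; the 8
    rounds up three times this, from the two Taylor remainders.\<close>
  have "measure M {y. \<bar>y\<bar> \<ge> \<eta>} \<le> 2 * (3 * (s * \<theta>) + 8 * (s * D)\<^sup>2)"
  proof (rule tail_le_char[OF \<eta>])
    fix u assume u: "0 \<le> u" "u \<le> 3 / \<eta>"
    have u2: "2 * u \<le> 6 / \<eta>" "u \<le> 6 / \<eta>" using u \<eta> by (auto simp: field_simps)
    have 1: "\<bar>Re (\<psi> x) - v / 2 * x\<^sup>2\<bar> \<le> \<theta>" if "0 \<le> x" "x \<le> 6 / \<eta>" for x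
      using order.trans[OF abs_Re_le_cmod \<psi>[OF that]] by (simp del: of_real_mult of_real_power)
    have "\<bar>Re (\<psi> u) - v / 2 * u\<^sup>2\<bar> \<le> \<theta>" "\<bar>Re (\<psi> (2 * u)) - 4 * (v / 2 * u\<^sup>2)\<bar> \<le> \<theta>"
      using 1[of u] 1[of "2 * u"] u u2 by (auto simp: power2_eq_square)
    moreover have "0 \<le> \<theta>" using 1[of 0] \<eta> by simp
    ultimately have "2 * Re (\<psi> u) - Re (\<psi> (2 * u)) / 2 \<le> 3 * \<theta>"
      by linarith
    from mult_left_mono[OF this s]
    have "2 * Re (of_real s * \<psi> u) - Re (of_real s * \<psi> (2 * u)) / 2 \<le> 3 * (s * \<theta>)"
      by (simp add: field_simps)
    with Re_exp_le[OF z_le, of u] Re_exp_le[OF z_le, of "2 * u"] u u2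
    show "3 / 2 - 2 * Re (char M u) + Re (char M (2 * u)) / 2 \<le> 3 * (s * \<theta>) + 8 * (s * D)\<^sup>2"
      using zero_le_power2[of "s * D"] unfolding char by linarith
  qed
  then show ?thesis by simp
qed

text \<open>Factoring out the Gaussian term, which is at most 1, leaves \<open>exp (- x) - 1\<close>
  with \<open>cmod x \<le> s * \<theta>\<close>. The linear term contributes 1 and the remainder 3
  to the constant 4.\<close>

lemma cmod_exp_diff_le:
  assumes s: "0 \<le> s" and z: "cmod (z - of_real w) \<le> \<theta>" and "0 \<le> w" and "s * \<theta> \<le> 1"
  shows "cmod (exp (- (of_real s * z)) - of_real (exp (- (s * w)))) \<le> 4 * (s * \<theta>)"
proof -
  define x where "x = of_real s * (z - of_real w)"
  have x: "cmod x \<le> s * \<theta>" using z s by (simp add: x_def norm_mult mult_left_mono)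
  then have x1: "cmod x \<le> 1" using assms by linarith
  have "exp (- (of_real s * z)) - of_real (exp (- (s * w))) = of_real (exp (- (s * w))) * (exp (- x) - 1)"
    by (simp add: x_def exp_of_real[symmetric] exp_add[symmetric] algebra_simps)
  also have "cmod \<dots> \<le> 1 * cmod (exp (- x) - 1)"
    unfolding norm_mult using assms by (intro mult_right_mono) auto
  finally have "cmod (exp (- (of_real s * z)) - of_real (exp (- (s * w)))) \<le> cmod (exp (- x) - 1)"
    by simp
  moreover have "cmod (exp (- x) - 1) \<le> cmod (exp (- x) - (1 - x)) + cmod x"
    using norm_triangle_ineq4[of "exp (- x) - (1 - x)" x] by (simp add: algebra_simps)
  moreover have "cmod (exp (- x) - (1 - x)) \<le> 3 * (cmod x)\<^sup>2" by (rule cmod_exp_minus_linear[OF x1])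
  moreover have "(cmod x)\<^sup>2 \<le> cmod x * 1" unfolding power2_eq_square using x1 by (intro mult_left_mono) auto
  ultimately show ?thesis using x by linarith
qed

text \<open>These make the gains linear in the time step: the first for the constant that does not
  decay in the lower bound, the second for the gap between two rates in the upper bound.\<close>

lemma exp_minus_bounds:
  fixes x :: real
  assumes "0 \<le> x" "x \<le> 1"
  shows "x / 2 \<le> 1 - exp (- x)" and "1 / 3 \<le> exp (- x)"
proof -
  have "exp (- x) \<le> 1 / (1 + x)"
    using exp_ge_add_one_self[of x] assms by (simp add: exp_minus inverse_eq_divide frac_le)
  also have "\<dots> \<le> 1 - x / 2"
  proof -
    have "0 \<le> x * (1 - x)" using assms by simp
    then show ?thesis using assms by (simp add: field_simps)
  qed
  finally show "x / 2 \<le> 1 - exp (- x)" by simp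
  have "exp x \<le> exp 1" using assms by simp
  also have "\<dots> \<le> 3" by (rule exp_le)
  finally show "1 / 3 \<le> exp (- x)" by (simp add: exp_minus field_simps)
qed

text \<open>\<open>V\<close>, \<open>\<theta>\<close> and \<open>h\<close> are chosen before the
  walk: every step law whose exponent is close to the Gaussian one on \<open>{0..V}\<close> is
  covered, and only the block duration \<open>real m * s\<close> must be small. The time step may
  thus shrink while the block keeps its length.\<close>

lemma kill_pow_lower_exponent:
  assumes a: "pi / 2 < a" "a \<le> pi" and v: "0 < v"
  obtains V \<theta> h where "0 < V" "0 < \<theta>" "0 < h"
    "\<And>M \<psi> s m n. real_distribution M \<Longrightarrow> 0 \<le> s \<Longrightarrow> (\<And>u. char M u = exp (- (of_real s * \<psi> u))) \<Longrightarrow>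
      (\<And>u. 0 \<le> u \<Longrightarrow> u \<le> V \<Longrightarrow> cmod (\<psi> u - of_real (v / 2 * u\<^sup>2)) \<le> \<theta>) \<Longrightarrow> real m * s \<le> h \<Longrightarrow>
      exp (- (real m * s * (v / 2 * a\<^sup>2))) ^ n \<le> (kill M ^^ (n * m)) (indicator {-1..1}) 0"
proof -
  have a0: "0 < a" using a pi_half_gt_zero by linarith
  \<comment> \<open>Halfway between \<open>pi / (2 * a)\<close> and 1, which leaves room on both
    sides.\<close>
  define r where "r = (pi / (2 * a) + 1) / 2"
  have "pi / (2 * a) < 1" using a a0 by (simp add: field_simps)
  then have r: "pi / (2 * a) < r" "r < 1" by (auto simp: r_def field_simps)
  then have ar: "pi / 2 < a * r" using a0 by (simp add: field_simps)
  define \<kappa> where "\<kappa> = - cos (a * r)"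
  have "a * r < a * 1" using r a0 by (intro mult_strict_left_mono) auto
  then have "a * r \<le> pi" using a by linarith
  then have "cos (a * r) < cos (pi / 2)" using ar by (intro cos_monotone_0_pi) auto
  then have \<kappa>: "0 < \<kappa>" by (simp add: \<kappa>_def)
  define \<eta> where "\<eta> = (1 - r) / 2"
  have \<eta>: "0 < \<eta>" using r by (simp add: \<eta>_def)
  define D where "D = v / 2 * (6 / \<eta>)\<^sup>2 + 1"
  have D: "1 \<le> D" using v by (simp add: D_def)
  define w where "w = v / 2 * a\<^sup>2"
  have w: "0 < w" using v a0 by (simp add: w_def)
  \<comment> \<open>A block of duration \<open>t\<close> gains at least
    \<open>\<kappa> * (t * w / 2)\<close>. The errors are \<open>28 * (t * \<theta>)\<close> and
    \<open>64 * (t * D)\<^sup>2\<close>, where 28 = 4 + 4 * 6 and 64 = 4 * 16; each is allotted half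
    of the gain. The 24 in \<open>h\<close> keeps the tails below 1/2.\<close>
  define \<theta> where "\<theta> = min 1 (\<kappa> * w / 112)"
  define h where "h = min (1 / (24 * D)) (min (1 / w) (\<kappa> * w / (256 * D\<^sup>2)))"
  have \<theta>: "0 < \<theta>" "\<theta> \<le> 1" "112 * \<theta> \<le> \<kappa> * w" using \<kappa> w by (auto simp: \<theta>_def)
  have h: "0 < h" using \<kappa> w D by (simp add: h_def)
  have hD: "h * D \<le> 1 / 24" "h * w \<le> 1" "256 * (h * D\<^sup>2) \<le> \<kappa> * w"
  proof -
    have "h \<le> 1 / (24 * D)" "h \<le> 1 / w" "h \<le> \<kappa> * w / (256 * D\<^sup>2)" by (auto simp: h_def)
    then show "h * D \<le> 1 / 24" "h * w \<le> 1" "256 * (h * D\<^sup>2) \<le> \<kappa> * w"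
      using D w by (auto simp: field_simps)
  qed
  show ?thesis
  \<comment> \<open>The tail estimate uses frequencies up to \<open>6 / \<eta>\<close> and the
    eigenvalue uses \<open>a\<close>; the sum covers both.\<close>
  proof (rule that[of "6 / \<eta> + a" \<theta> h])
    fix M \<psi> s m n
    assume "real_distribution M" and s: "0 \<le> s" and char: "\<And>u. char M u = exp (- (of_real s * \<psi> u))"
      and \<psi>: "\<And>u. 0 \<le> u \<Longrightarrow> u \<le> 6 / \<eta> + a \<Longrightarrow> cmod (\<psi> u - of_real (v / 2 * u\<^sup>2)) \<le> \<theta>"
      and ms: "real m * s \<le> h"
    interpret real_distribution M by fact
    define t where "t = real m * s"
    have t: "0 \<le> t" "t \<le> h" using s ms by (auto simp: t_def)
    have tD: "t * D \<le> 1 / 24" "t * w \<le> 1"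
    proof -
      have "t * D \<le> h * D" "t * w \<le> h * w" using t D w by (intro mult_right_mono; simp)+
      then show "t * D \<le> 1 / 24" "t * w \<le> 1" using hD by linarith+
    qed
    have t\<theta>: "t * \<theta> \<le> 1 / 24"
    proof -
      have "t * \<theta> \<le> t * D" using t \<theta> D by (intro mult_left_mono) auto
      then show ?thesis using tD by linarith
    qed
    have char_pow: "char M u ^ i = exp (- (of_real (real i * s) * \<psi> u))" for u i
      by (simp add: char exp_of_nat_mult[symmetric] mult_ac)
    \<comment> \<open>Ottaviani's inequality asks for every partial block, so each is bounded in
      terms of the full duration \<open>t\<close>.\<close>
    have tail: "measure (convolution_power M i) {y. \<bar>y\<bar> \<ge> \<eta>} \<le> 6 * (t * \<theta>) + 16 * (t * D)\<^sup>2"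
      if "i \<le> m" for i
    proof -
      interpret P: real_distribution "convolution_power M i" by (rule real_distribution_power)
      have is_le: "real i * s \<le> t" using that s by (simp add: t_def mult_right_mono)
      have is_D: "real i * s * D \<le> t * D" using is_le D by (intro mult_right_mono) auto
      have "measure (convolution_power M i) {y. \<bar>y\<bar> \<ge> \<eta>}
          \<le> 6 * (real i * s * \<theta>) + 16 * (real i * s * D)\<^sup>2"
      proof (rule P.tail_le_exponent[OF \<eta>])
        show "char (convolution_power M i) u = exp (- (of_real (real i * s) * \<psi> u))" for u
          unfolding char_convolution_power by (rule char_pow)
        show "cmod (\<psi> u - of_real (v / 2 * u\<^sup>2)) \<le> \<theta>" if "0 \<le> u" "u \<le> 6 / \<eta>" for u
          using that a0 by (intro \<psi>) auto
      qed (use s \<theta> v is_D tD in \<open>auto simp: D_def\<close>)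
      also have "\<dots> \<le> 6 * (t * \<theta>) + 16 * (t * D)\<^sup>2"
        using is_le is_D s D \<theta> by (intro add_mono mult_left_mono power_mono mult_right_mono) auto
      finally show ?thesis .
    qed
    have tDsq: "(t * D)\<^sup>2 \<le> 1 / 24 * (t * D)" 
      unfolding power2_eq_square using tD t D by (intro mult_right_mono) auto
    have "exp (- (t * w)) ^ n \<le> (kill M ^^ (n * m)) (indicator {-1..1}) 0"
    proof (rule kill_pow_lower[OF a ar r(2)])
      show "measure (convolution_power M i) {y. \<bar>y\<bar> \<ge> (1 - r) / 2} \<le> 1 / 2" if "i \<le> m" for i
        using tail[OF that] tDsq tD t\<theta> by (simp add: \<eta>_def)
      have "cmod (char M a ^ m - of_real (exp (- (t * w)))) \<le> 4 * (t * \<theta>)"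
        unfolding char_pow t_def[symmetric] using t w t\<theta> \<psi>[of a] a0 \<eta>
        by (intro cmod_exp_diff_le) (auto simp: w_def)
      moreover have "measure (convolution_power M m) {y. \<bar>y\<bar> \<ge> (1 - r) / 2} \<le> 6 * (t * \<theta>) + 16 * (t * D)\<^sup>2"
        using tail[of m] by (simp add: \<eta>_def)
      moreover have "28 * (t * \<theta>) + 64 * (t * D)\<^sup>2 \<le> \<kappa> * (t * w / 2)"
      proof -
        have "64 * (t * D)\<^sup>2 = t * (64 * (t * D\<^sup>2))" by (simp add: power2_eq_square)
        also have "t * D\<^sup>2 \<le> h * D\<^sup>2" using t by (intro mult_right_mono) auto
        finally have "64 * (t * D)\<^sup>2 \<le> t * (64 * (h * D\<^sup>2))" using t by (simp add: mult_left_mono)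
        then have "28 * (t * \<theta>) + 64 * (t * D)\<^sup>2 \<le> t * (28 * \<theta> + 64 * (h * D\<^sup>2))"
          by (simp add: algebra_simps)
        also have "\<dots> \<le> t * (\<kappa> * w / 2)" using t \<theta> hD by (intro mult_left_mono) linarith+
        finally show ?thesis by (simp add: algebra_simps)
      qed
      moreover have "\<kappa> * (t * w / 2) \<le> \<kappa> * (1 - exp (- (t * w)))"
        using \<kappa> t w tD exp_minus_bounds(1)[of "t * w"] by (intro mult_left_mono) auto
      ultimately show "cmod (char M a ^ m - of_real (exp (- (t * w))))
        + 4 * measure (convolution_power M m) {y. \<bar>y\<bar> \<ge> (1 - r) / 2} \<le> - cos (a * r) * (1 - exp (- (t * w)))"
        unfolding \<kappa>_def[symmetric] by linarith
    qed simp
    then show "exp (- (real m * s * (v / 2 * a\<^sup>2))) ^ n \<le> (kill M ^^ (n * m)) (indicator {-1..1}) 0"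
      by (simp add: t_def w_def)
  qed (use \<theta> h \<eta> a0 in \<open>auto intro: add_pos_pos\<close>)
qed

text \<open>\<open>kill_pow_upper\<close> is applied with the eigenvalue of frequency
  \<open>a\<close> as \<open>e\<close> and that of the smaller frequency \<open>a'\<close> as
  \<open>q\<close>. Their difference is bounded below linearly in \<open>s\<close>, and the errors
  are a small multiple of \<open>s\<close>. Again the constants are uniform over walks.\<close>

lemma kill_pow_upper_exponent:
  assumes a: "0 < a'" "a' < a" "a < pi / 2" and v: "0 < v"
  obtains V \<theta> h where "0 < V" "0 < \<theta>" "0 < h"
    "\<And>M \<psi> s n. real_distribution M \<Longrightarrow> 0 \<le> s \<Longrightarrow> (\<And>u. char M u = exp (- (of_real s * \<psi> u))) \<Longrightarrow>
      (\<And>u. 0 \<le> u \<Longrightarrow> u \<le> V \<Longrightarrow> cmod (\<psi> u - of_real (v / 2 * u\<^sup>2)) \<le> \<theta>) \<Longrightarrow> s \<le> h \<Longrightarrow>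
      (kill M ^^ n) (indicator {-1..1}) 0 \<le> exp (- (s * (v / 2 * a'\<^sup>2))) ^ n / cos a"
proof -
  have a0: "0 < a" using a by linarith
  define \<eta> where "\<eta> = pi / (2 * a) - 1"
  have \<eta>: "0 < \<eta>" using a a0 by (simp add: \<eta>_def field_simps)
  have ca: "0 < cos a" using a a0 by (intro cos_gt_zero) auto
  define D where "D = v / 2 * (6 / \<eta>)\<^sup>2 + 1"
  have D: "1 \<le> D" using v by (simp add: D_def)
  define w where "w = v / 2 * a\<^sup>2"
  define w' where "w' = v / 2 * a'\<^sup>2"
  have w': "0 < w'" using v a by (simp add: w'_def)
  have ww: "w' < w" unfolding w_def w'_def using v a by (intro mult_strict_left_mono power_strict_mono) auto
  \<comment> \<open>The 3 comes from \<open>1 / 3 \<le> exp (- (s * w))\<close>; with it,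
    \<open>s * g\<close> is a lower bound for the slack required by
    \<open>kill_pow_upper\<close>.\<close>
  define g where "g = cos a * (w - w') / 3"
  have g: "0 < g" using ca ww by (simp add: g_def)
  \<comment> \<open>The errors are \<open>10 * (s * \<theta>)\<close>, where 10 = 4 + 6, and
    \<open>16 * (s * D)\<^sup>2\<close>; each may use half of \<open>s * g\<close>.\<close>
  define \<theta> where "\<theta> = min 1 (g / 20)"
  define h where "h = min (1 / D) (min (1 / w) (g / (32 * D\<^sup>2)))"
  have \<theta>: "0 < \<theta>" "\<theta> \<le> 1" "20 * \<theta> \<le> g" using g by (auto simp: \<theta>_def)
  have h: "0 < h" using g w' ww D by (simp add: h_def)
  have hD: "h * D \<le> 1" "h * w \<le> 1" "32 * (h * D\<^sup>2) \<le> g"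
  proof -
    have "h \<le> 1 / D" "h \<le> 1 / w" "h \<le> g / (32 * D\<^sup>2)" by (auto simp: h_def)
    then show "h * D \<le> 1" "h * w \<le> 1" "32 * (h * D\<^sup>2) \<le> g"
      using D w' ww by (auto simp: field_simps)
  qed
  show ?thesis
  proof (rule that[of "6 / \<eta> + a" \<theta> h])
    fix M \<psi> s n
    assume "real_distribution M" and s: "0 \<le> s" and char: "\<And>u. char M u = exp (- (of_real s * \<psi> u))"
      and \<psi>: "\<And>u. 0 \<le> u \<Longrightarrow> u \<le> 6 / \<eta> + a \<Longrightarrow> cmod (\<psi> u - of_real (v / 2 * u\<^sup>2)) \<le> \<theta>"
      and sh: "s \<le> h"
    interpret real_distribution M by fact
    have sD: "s * D \<le> 1" "s * w \<le> 1"
    proof -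
      have "s * D \<le> h * D" "s * w \<le> h * w" using sh D w' ww by (intro mult_right_mono; simp)+
      then show "s * D \<le> 1" "s * w \<le> 1" using hD by linarith+
    qed
    have s\<theta>: "s * \<theta> \<le> 1"
    proof -
      have "s * \<theta> \<le> s * D" using s \<theta> D by (intro mult_left_mono) auto
      then show ?thesis using sD by linarith
    qed
    have tail: "measure M {y. \<bar>y\<bar> \<ge> \<eta>} \<le> 6 * (s * \<theta>) + 16 * (s * D)\<^sup>2"
      by (rule tail_le_exponent[OF \<eta> s char, where v = v]) (use \<psi> a0 \<theta> v sD in \<open>auto simp: D_def\<close>)
    have "(kill M ^^ n) (indicator {-1..1}) 0 \<le> exp (- (s * w')) ^ n / cos a"
    proof (rule kill_pow_upper[OF a0 a(3)])
      have "cmod (char M a - of_real (exp (- (s * w)))) \<le> 4 * (s * \<theta>)"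
        unfolding char using s w' ww s\<theta> \<psi>[of a] a0 \<eta>
        by (intro cmod_exp_diff_le) (auto simp: w_def)
      moreover have "10 * (s * \<theta>) + 16 * (s * D)\<^sup>2 \<le> s * g"
      proof -
        have "16 * (s * D)\<^sup>2 = s * (16 * (s * D\<^sup>2))" by (simp add: power2_eq_square)
        also have "s * D\<^sup>2 \<le> h * D\<^sup>2" using sh by (intro mult_right_mono) auto
        finally have "16 * (s * D)\<^sup>2 \<le> s * (16 * (h * D\<^sup>2))" using s by (simp add: mult_left_mono)
        then have "10 * (s * \<theta>) + 16 * (s * D)\<^sup>2 \<le> s * (10 * \<theta> + 16 * (h * D\<^sup>2))"
          by (simp add: algebra_simps)
        also have "\<dots> \<le> s * g" using s \<theta> hD by (intro mult_left_mono) linarith+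
        finally show ?thesis .
      qed
      moreover have "s * g \<le> cos a * (exp (- (s * w')) - exp (- (s * w)))"
      proof -
        have "1 / 3 * (s * (w - w')) \<le> exp (- (s * w)) * (exp (s * (w - w')) - 1)"
        proof (rule mult_mono)
          show "s * (w - w') \<le> exp (s * (w - w')) - 1"
            using exp_ge_add_one_self[of "s * (w - w')"] by linarith
        qed (use exp_minus_bounds(2)[of "s * w"] s w' ww sD in auto)
        also have "\<dots> = exp (- (s * w')) - exp (- (s * w))"
          by (simp add: algebra_simps exp_add[symmetric])
        finally have "cos a * (1 / 3 * (s * (w - w'))) \<le> cos a * (exp (- (s * w')) - exp (- (s * w)))"
          using ca by (intro mult_left_mono) auto
        then show ?thesis by (simp add: g_def mult_ac)
      qed
      ultimately show "cmod (char M a - of_real (exp (- (s * w)))) + measure M {y. \<bar>y\<bar> \<ge> pi / (2 * a) - 1}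
         \<le> cos a * (exp (- (s * w')) - exp (- (s * w)))"
        using tail unfolding \<eta>_def by linarith
    qed
    then show "(kill M ^^ n) (indicator {-1..1}) 0 \<le> exp (- (s * (v / 2 * a'\<^sup>2))) ^ n / cos a"
      by (simp add: w'_def)
  qed (use \<theta> h \<eta> a0 in \<open>auto intro: add_pos_pos\<close>)
qed

section \<open>Scaling of the Levy exponent\<close>

text \<open>After rescaling, the quadratic bound yields a majorant independent of the scale, and the
  linear bound yields the decay.\<close>

lemma cmod_compensated_iexp_le:
  "cmod (1 - iexp y + \<i> * of_real y) \<le> \<bar>y\<bar>\<^sup>2 / 2" "cmod (1 - iexp y + \<i> * of_real y) \<le> 2 * \<bar>y\<bar>"
proof -
  have eq: "cmod (1 - iexp y + \<i> * of_real y) = cmod (iexp y - (\<Sum>k\<le>1. (\<i> * y) ^ k / fact k))"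
    by (subst norm_minus_cancel[symmetric]) (simp add: algebra_simps)
  show "cmod (1 - iexp y + \<i> * of_real y) \<le> \<bar>y\<bar>\<^sup>2 / 2"
    unfolding eq using iexp_approx1[of y 1] by (simp add: numeral_2_eq_2)
  show "cmod (1 - iexp y + \<i> * of_real y) \<le> 2 * \<bar>y\<bar>"
    unfolding eq using iexp_approx2[of y 1] by simp
qed

lemma levy_measure_integrable:
  assumes "levy_measure \<nu>"
  shows "integrable \<nu> (\<lambda>x. min 1 (x\<^sup>2))"
    and "f \<in> borel_measurable borel \<Longrightarrow> f \<in> borel_measurable \<nu>"
proof -
  have sets: "sets \<nu> = sets (restrict_space borel (UNIV - {0}))"
    and fin: "(\<integral>\<^sup>+x. ennreal (min 1 (x\<^sup>2)) \<partial>\<nu>) < \<infinity>"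
    using assms by (auto simp: levy_measure_def)
  show meas: "f \<in> borel_measurable \<nu>" if "f \<in> borel_measurable borel" for f :: "real \<Rightarrow> 'b::topological_space"
    using measurable_restrict_space1[OF that] sets by (simp cong: measurable_cong_sets)
  have "(\<lambda>x::real. min 1 (x\<^sup>2)) \<in> borel_measurable borel" by measurable
  from meas[OF this] show "integrable \<nu> (\<lambda>x. min 1 (x\<^sup>2))"
    using fin by (intro integrableI_bounded) (auto simp: abs_of_nonneg)
qed

text \<open>The Gaussian term is invariant under the scaling and the drift shrinks to
  \<open>b * u * \<epsilon>\<close>. The jump term tends to 0 by dominated convergence, through a
  majorant free of \<open>u\<close>, whence the uniformity on \<open>{0..V}\<close>.\<close>

lemma levy_exponent_scaling:
  assumes \<nu>: "levy_measure \<nu>" and V: "0 \<le> V" and \<theta>: "0 < \<theta>"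
  shows "\<forall>\<^sub>F \<epsilon> in at_right 0. \<forall>u. 0 \<le> u \<longrightarrow> u \<le> V \<longrightarrow>
    cmod (of_real (\<epsilon>\<^sup>2) * levy_exponent \<nu> v b (u / \<epsilon>) - of_real (v / 2 * u\<^sup>2)) \<le> \<theta>"
proof -
  \<comment> \<open>For small jumps, \<epsilon>^2 times the two bounds of
    \<open>cmod_compensated_iexp_le\<close> at u x / \<epsilon>, with \<open>u \<le> V\<close>.
    Large jumps are not compensated, and there \<open>1 - iexp\<close> has modulus at most
    2.\<close>
  define K where "K \<epsilon> x = (if \<bar>x\<bar> \<le> 1 then min (V\<^sup>2 * x\<^sup>2) (2 * V * \<epsilon> * \<bar>x\<bar>) else 2 * \<epsilon>\<^sup>2)" for \<epsilon> x :: real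
  have [measurable]: "K \<epsilon> \<in> borel_measurable \<nu>" for \<epsilon>
    by (rule levy_measure_integrable(2)[OF \<nu>]) (unfold K_def, measurable)
  have K_nonneg: "0 \<le> K \<epsilon> x" if "0 \<le> \<epsilon>" for \<epsilon> x using that V by (simp add: K_def)
  have K_le: "K \<epsilon> x \<le> (V\<^sup>2 + 2) * min 1 (x\<^sup>2)" if "0 \<le> \<epsilon>" "\<epsilon> \<le> 1" for \<epsilon> x
  proof (cases "\<bar>x\<bar> \<le> 1")
    case True
    then have "x\<^sup>2 \<le> 1" by (simp add: abs_square_le_1)
    moreover have "K \<epsilon> x \<le> V\<^sup>2 * x\<^sup>2" using True by (simp add: K_def)
    moreover have "V\<^sup>2 * x\<^sup>2 \<le> (V\<^sup>2 + 2) * x\<^sup>2" by (intro mult_right_mono) auto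
    ultimately show ?thesis by simp
  next
    case False
    then have "1 \<le> x\<^sup>2" using abs_square_le_1[of x] by linarith
    moreover have "\<epsilon>\<^sup>2 \<le> 1" using that by (simp add: abs_square_le_1)
    ultimately show ?thesis using False by (auto simp: K_def intro: add_increasing)
  qed
  have K_small: "K \<epsilon> x \<le> 2 * V * \<epsilon> * \<bar>x\<bar> + 2 * \<epsilon>\<^sup>2" if "0 \<le> \<epsilon>" for \<epsilon> x
    using that V by (auto simp: K_def intro: add_increasing add_increasing2 min.coboundedI2)
  have K_int: "integrable \<nu> (K \<epsilon>)" if "0 \<le> \<epsilon>" "\<epsilon> \<le> 1" for \<epsilon>
    by (rule Bochner_Integration.integrable_bound[OF integrable_mult_right[of "V\<^sup>2 + 2", OF levy_measure_integrable(1)[OF \<nu>]]])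
      (use K_nonneg[OF that(1)] K_le[OF that] in \<open>auto simp: abs_of_nonneg\<close>)
  \<comment> \<open>Dominated convergence is applied along a sequence; monotonicity carries the
    estimate from one of its members to all smaller \<epsilon>.\<close>
  have K_mono: "K \<epsilon> x \<le> K \<delta> x" if "0 \<le> \<epsilon>" "\<epsilon> \<le> \<delta>" for \<epsilon> \<delta> x
  proof -
    have "2 * V * \<epsilon> * \<bar>x\<bar> \<le> 2 * V * \<delta> * \<bar>x\<bar>" "\<epsilon>\<^sup>2 \<le> \<delta>\<^sup>2"
      using that V by (auto intro!: mult_right_mono mult_left_mono power_mono)
    then show ?thesis by (auto simp: K_def)
  qed
  have "(\<lambda>n. \<integral>x. K (inverse (real (Suc n))) x \<partial>\<nu>) \<longlonglongrightarrow> (\<integral>x. 0 \<partial>\<nu>)"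
  proof (rule integral_dominated_convergence)
    show "integrable \<nu> (\<lambda>x. (V\<^sup>2 + 2) * min 1 (x\<^sup>2))"
      by (intro integrable_mult_right levy_measure_integrable(1)[OF \<nu>])
    show "AE x in \<nu>. norm (K (inverse (real (Suc n))) x) \<le> (V\<^sup>2 + 2) * min 1 (x\<^sup>2)" for n
      using K_nonneg K_le[of "inverse (real (Suc n))"]
      by (auto simp: abs_of_nonneg field_simps)
    have "(\<lambda>n. K (inverse (real (Suc n))) x) \<longlonglongrightarrow> 0" for x
    proof (rule tendsto_sandwich[OF _ _ tendsto_const])
      have "(\<lambda>n. 2 * V * inverse (real (Suc n)) * \<bar>x\<bar> + 2 * (inverse (real (Suc n)))\<^sup>2) \<longlonglongrightarrow>
          2 * V * 0 * \<bar>x\<bar> + 2 * 0\<^sup>2"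
        by (intro tendsto_intros LIMSEQ_inverse_real_of_nat)
      then show "(\<lambda>n. 2 * V * inverse (real (Suc n)) * \<bar>x\<bar> + 2 * (inverse (real (Suc n)))\<^sup>2) \<longlonglongrightarrow> 0"
        by simp
    qed (use K_nonneg K_small in auto)
    then show "AE x in \<nu>. (\<lambda>n. K (inverse (real (Suc n))) x) \<longlonglongrightarrow> 0" by simp
  qed simp_all
  then have "\<forall>\<^sub>F n in sequentially. (\<integral>x. K (inverse (real (Suc n))) x \<partial>\<nu>) < \<theta> / 2"
    using \<theta> by (intro order_tendstoD) auto
  then obtain n where n: "(\<integral>x. K (inverse (real (Suc n))) x \<partial>\<nu>) < \<theta> / 2"
    by (auto simp: eventually_sequentially)
  define \<delta> where "\<delta> = inverse (real (Suc n))"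
  have \<delta>: "0 < \<delta>" "\<delta> \<le> 1" by (auto simp: \<delta>_def field_simps)
  have "((\<lambda>\<epsilon>. \<bar>b\<bar> * V * \<epsilon>) \<longlongrightarrow> \<bar>b\<bar> * V * 0) (at_right 0)" by (intro tendsto_intros)
  then have "\<forall>\<^sub>F \<epsilon> in at_right 0. \<bar>b\<bar> * V * \<epsilon> < \<theta> / 2" using \<theta> by (intro order_tendstoD) auto
  moreover have "\<forall>\<^sub>F \<epsilon> in at_right 0. \<epsilon> < \<delta>" using \<delta>(1) by (rule order_tendstoD(2)[OF tendsto_ident_at])
  moreover have "\<forall>\<^sub>F \<epsilon>::real in at_right 0. 0 < \<epsilon>" by (rule eventually_at_right_less)
  ultimately show ?thesis
  proof eventually_elim
    case (elim \<epsilon>)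
    show ?case
    proof (intro allI impI)
      fix u assume u: "0 \<le> u" "u \<le> V"
      define F where "F x = 1 - iexp (u / \<epsilon> * x) + indicator {x. \<bar>x\<bar> \<le> 1} x * (\<i> * of_real (u / \<epsilon> * x))" for x
      have F_le: "norm (of_real (\<epsilon>\<^sup>2) * F x) \<le> K \<epsilon> x" for x
      proof (cases "\<bar>x\<bar> \<le> 1")
        case True
        define y where "y = u / \<epsilon> * x"
        have F: "F x = 1 - iexp y + \<i> * of_real y" using True by (simp add: F_def y_def)
        have "\<epsilon>\<^sup>2 * cmod (F x) \<le> \<epsilon>\<^sup>2 * (\<bar>y\<bar>\<^sup>2 / 2)"
          unfolding F by (intro mult_left_mono cmod_compensated_iexp_le) auto
        also have "\<dots> = (\<epsilon> * y)\<^sup>2 / 2" by (simp add: power_mult_distrib)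
        also have "\<epsilon> * y = u * x" using elim by (simp add: y_def)
        also have "(u * x)\<^sup>2 / 2 \<le> (u * x)\<^sup>2" by simp
        also have "\<dots> \<le> V\<^sup>2 * x\<^sup>2"
          unfolding power_mult_distrib using u by (intro mult_right_mono power_mono) auto
        finally have 1: "\<epsilon>\<^sup>2 * cmod (F x) \<le> V\<^sup>2 * x\<^sup>2" .
        have "\<epsilon>\<^sup>2 * cmod (F x) \<le> \<epsilon>\<^sup>2 * (2 * \<bar>y\<bar>)"
          unfolding F by (intro mult_left_mono cmod_compensated_iexp_le) auto
        also have "\<dots> = 2 * \<epsilon> * \<bar>\<epsilon> * y\<bar>" using elim by (simp add: power2_eq_square abs_mult)
        also have "\<epsilon> * y = u * x" using elim by (simp add: y_def)
        also have "2 * \<epsilon> * \<bar>u * x\<bar> = 2 * u * \<epsilon> * \<bar>x\<bar>" using u by (simp add: abs_mult)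
        also have "\<dots> \<le> 2 * V * \<epsilon> * \<bar>x\<bar>" using u elim by (intro mult_right_mono) auto
        finally show ?thesis using 1 True by (simp add: K_def norm_mult norm_power)
      next
        case False
        have "cmod (1 - iexp (u / \<epsilon> * x)) \<le> 1 + 1"
          using norm_triangle_ineq4[of 1 "iexp (u / \<epsilon> * x)"] by simp
        then have "\<epsilon>\<^sup>2 * cmod (1 - iexp (u / \<epsilon> * x)) \<le> \<epsilon>\<^sup>2 * (1 + 1)" by (intro mult_left_mono) auto
        then show ?thesis using False by (simp add: F_def K_def norm_mult norm_power)
      qed
      have "norm (of_real (\<epsilon>\<^sup>2) * (\<integral>x. F x \<partial>\<nu>)) = norm (\<integral>x. of_real (\<epsilon>\<^sup>2) * F x \<partial>\<nu>)" by simp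
      also have "\<dots> \<le> (\<integral>x. norm (of_real (\<epsilon>\<^sup>2) * F x) \<partial>\<nu>)" by (rule integral_norm_bound)
      also have "\<dots> \<le> (\<integral>x. K \<epsilon> x \<partial>\<nu>)"
        using elim \<delta> F_le K_nonneg by (intro integral_mono' K_int) auto
      also have "\<dots> \<le> (\<integral>x. K \<delta> x \<partial>\<nu>)" using elim \<delta> by (intro integral_mono K_int K_mono) auto
      also have "\<dots> < \<theta> / 2" using n by (simp add: \<delta>_def)
      finally have 1: "norm (of_real (\<epsilon>\<^sup>2) * (\<integral>x. F x \<partial>\<nu>)) < \<theta> / 2" .
      have "of_real (\<epsilon>\<^sup>2) * levy_exponent \<nu> v b (u / \<epsilon>) - of_real (v / 2 * u\<^sup>2)
          = of_real (\<epsilon>\<^sup>2) * (\<integral>x. F x \<partial>\<nu>) - \<i> * of_real (b * u * \<epsilon>)"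
        unfolding levy_exponent_def F_def[symmetric] using elim by (simp add: field_simps power2_eq_square)
      also have "cmod \<dots> \<le> cmod (of_real (\<epsilon>\<^sup>2) * (\<integral>x. F x \<partial>\<nu>)) + cmod (\<i> * of_real (b * u * \<epsilon>))"
        by (rule norm_triangle_ineq4)
      also have "cmod (\<i> * of_real (b * u * \<epsilon>)) = \<bar>b\<bar> * u * \<epsilon>"
        using u elim unfolding norm_mult norm_of_real by (simp add: abs_mult)
      also have "\<dots> \<le> \<bar>b\<bar> * V * \<epsilon>" using u elim by (intro mult_right_mono mult_left_mono) auto
      finally show "cmod (of_real (\<epsilon>\<^sup>2) * levy_exponent \<nu> v b (u / \<epsilon>) - of_real (v / 2 * u\<^sup>2)) \<le> \<theta>"
        using 1 elim by linarith
    qed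
  qed
qed

section \<open>Levy processes on grids\<close>

text \<open>Freezing: the joint law is a product, so by Fubini \<open>W\<close> may be averaged
  while \<open>U\<close> is held fixed.\<close>

lemma (in prob_space) expectation_indep_var:
  fixes g :: "'b \<Rightarrow> 'b \<Rightarrow> real"
  assumes indep: "indep_var S U T W"
    and g: "(\<lambda>(u, w). g u w) \<in> borel_measurable (S \<Otimes>\<^sub>M T)" and B: "\<And>u w. \<bar>g u w\<bar> \<le> B"
  shows "expectation (\<lambda>\<omega>. g (U \<omega>) (W \<omega>)) = expectation (\<lambda>\<omega>. expectation (\<lambda>\<omega>'. g (U \<omega>) (W \<omega>')))"
proof -
  have [measurable]: "random_variable S U" "random_variable T W"
    using indep_var_rv1[OF indep] indep_var_rv2[OF indep] by auto
  interpret U: prob_space "distr M S U" by (rule prob_space_distr) measurable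
  interpret W: prob_space "distr M T W" by (rule prob_space_distr) measurable
  interpret UW: pair_prob_space "distr M S U" "distr M T W" ..
  note [measurable] = g
  have int: "integrable (distr M S U \<Otimes>\<^sub>M distr M T W) (\<lambda>(u, w). g u w)"
    by (rule UW.integrable_const_bound[of _ B]) (auto simp: B split: prod.split)
  have "expectation (\<lambda>\<omega>. g (U \<omega>) (W \<omega>))
      = (\<integral>p. (case p of (u, w) \<Rightarrow> g u w) \<partial>distr M (S \<Otimes>\<^sub>M T) (\<lambda>\<omega>. (U \<omega>, W \<omega>)))"
    by (subst integral_distr) auto
  also have "\<dots> = (\<integral>p. (case p of (u, w) \<Rightarrow> g u w) \<partial>(distr M S U \<Otimes>\<^sub>M distr M T W))"
    using indep by (simp add: indep_var_distribution_eq)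
  also have "\<dots> = (\<integral>u. (\<integral>w. g u w \<partial>distr M T W) \<partial>distr M S U)"
    using UW.integral_fst'[OF int] by simp
  also have "\<dots> = expectation (\<lambda>\<omega>. \<integral>w. g (U \<omega>) w \<partial>distr M T W)"
    by (subst integral_distr) auto
  also have "\<dots> = expectation (\<lambda>\<omega>. expectation (\<lambda>\<omega>'. g (U \<omega>) (W \<omega>')))"
  proof (rule Bochner_Integration.integral_cong[OF refl])
    fix \<omega> assume "\<omega> \<in> space M"
    then have "U \<omega> \<in> space S" by (rule measurable_space[OF \<open>random_variable S U\<close>])
    then have "(\<lambda>w. g (U \<omega>) w) \<in> borel_measurable T"
      using measurable_compose[OF measurable_Pair1' g] by (simp add: comp_def)
    then show "(\<integral>w. g (U \<omega>) w \<partial>distr M T W) = expectation (\<lambda>\<omega>'. g (U \<omega>) (W \<omega>'))"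
      by (subst integral_distr) auto
  qed
  finally show ?thesis .
qed

text \<open>Peel off the last step: averaging over it with the earlier steps frozen turns
  \<open>f\<close> into \<open>kill \<mu> f\<close>, whose barrier absorbs the last factor of the
  product. The induction therefore varies \<open>f\<close>.\<close>

lemma (in prob_space) expectation_killed_walk:
  assumes indep: "indep_vars (\<lambda>_. borel) \<xi> {..<N}"
    and law: "\<And>i. i < N \<Longrightarrow> distr M borel (\<xi> i) = \<mu>"
    and f: "bounded_borel f" and "k \<le> N"
  shows "expectation (\<lambda>\<omega>. f (\<Sum>i<k. \<xi> i \<omega>) * (\<Prod>j<k. indicator {-1..1} (\<Sum>i<j. \<xi> i \<omega>)))
    = (kill \<mu> ^^ k) f 0"
  using f \<open>k \<le> N\<close>
proof (induction k arbitrary: f)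
  case 0
  then show ?case by (simp add: prob_space)
next
  case (Suc k)
  have rv[measurable]: "random_variable borel (\<xi> i)" if "i < N" for i
    using indep that by (auto simp: indep_vars_def)
  have \<mu>: "real_distribution \<mu>"
    using real_distribution_distr[OF rv[of k]] law[of k] Suc by simp
  interpret \<mu>: real_distribution \<mu> by (rule \<mu>)
  have [measurable]: "f \<in> borel_measurable borel" using Suc by auto
  obtain B where B: "\<And>x. \<bar>f x\<bar> \<le> B" using Suc by (auto simp: bounded_borel_def)
  have ind: "indep_var (\<Pi>\<^sub>M i\<in>{..<k}. borel) (\<lambda>\<omega>. restrict (\<lambda>i. \<xi> i \<omega>) {..<k})
      (\<Pi>\<^sub>M i\<in>{k}. borel) (\<lambda>\<omega>. restrict (\<lambda>i. \<xi> i \<omega>) {k})"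
    using Suc by (intro indep_var_restrict[OF indep]) auto
  define g where "g u w = f ((\<Sum>i<k. u i) + w k) * (\<Prod>j<Suc k. indicator {-1..1} (\<Sum>i<j. u i))"
    for u w :: "nat \<Rightarrow> real"
  have g_restrict: "g (restrict u {..<k}) (restrict w {k}) = g u w" for u w
    by (auto simp: g_def intro!: arg_cong2[where f = "(*)"] prod.cong)
  have [measurable]: "(\<lambda>(u, w). g u w) \<in> borel_measurable ((\<Pi>\<^sub>M i\<in>{..<k}. borel) \<Otimes>\<^sub>M (\<Pi>\<^sub>M i\<in>{k}. borel))"
    unfolding g_def by measurable
  have prod_ind: "(\<Prod>j<n. indicator {-1..1} (h j) :: real) \<in> {0..1}" for n and h :: "nat \<Rightarrow> real"
    by (auto intro!: prod_nonneg prod_le_1)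
  have g_le: "\<bar>g u w\<bar> \<le> B" for u w
    using mult_mono[OF B[of "(\<Sum>i<k. u i) + w k"], of "\<Prod>j<Suc k. indicator {-1..1} (\<Sum>i<j. u i)" 1] prod_ind[of _ "Suc k"] B[of 0]
    by (auto simp: g_def abs_mult simp del: prod.lessThan_Suc)
  have "expectation (\<lambda>\<omega>. f (\<Sum>i<Suc k. \<xi> i \<omega>) * (\<Prod>j<Suc k. indicator {-1..1} (\<Sum>i<j. \<xi> i \<omega>)))
     = expectation (\<lambda>\<omega>. g (restrict (\<lambda>i. \<xi> i \<omega>) {..<k}) (restrict (\<lambda>i. \<xi> i \<omega>) {k}))"
    unfolding g_restrict by (simp add: g_def)
  also have "\<dots> = expectation (\<lambda>\<omega>. expectation (\<lambda>\<omega>'. g (restrict (\<lambda>i. \<xi> i \<omega>) {..<k}) (restrict (\<lambda>i. \<xi> i \<omega>') {k})))"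
    by (rule expectation_indep_var[OF ind _ g_le]) measurable
  also have "\<dots> = expectation (\<lambda>\<omega>. kill \<mu> f (\<Sum>i<k. \<xi> i \<omega>) * (\<Prod>j<k. indicator {-1..1} (\<Sum>i<j. \<xi> i \<omega>)))"
  proof (rule Bochner_Integration.integral_cong[OF refl])
    fix \<omega>
    have "expectation (\<lambda>\<omega>'. f (x + \<xi> k \<omega>')) = (\<integral>y. f (x + y) \<partial>\<mu>)" for x
      using Suc rv[of k] by (simp add: law[of k, symmetric] integral_distr)
    then show "expectation (\<lambda>\<omega>'. g (restrict (\<lambda>i. \<xi> i \<omega>) {..<k}) (restrict (\<lambda>i. \<xi> i \<omega>') {k}))
        = kill \<mu> f (\<Sum>i<k. \<xi> i \<omega>) * (\<Prod>j<k. indicator {-1..1} (\<Sum>i<j. \<xi> i \<omega>))"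
      unfolding g_restrict by (auto simp: g_def kill_def indicator_def abs_le_iff)
  qed
  also have "\<dots> = (kill \<mu> ^^ k) (kill \<mu> f) 0"
    using Suc by (intro Suc.IH \<mu>.bounded_borel_kill) auto
  finally show ?case by (simp add: funpow_swap1)
qed

section \<open>The process sampled on a grid as a killed walk\<close>

context levy_process
begin

lemma distr_increment:
  assumes "0 \<le> s" "0 \<le> h" "s + h \<le> 1"
  shows "distr M borel (\<lambda>\<omega>. (X (s + h) \<omega> - X s \<omega>) / c) = distr M borel (\<lambda>\<omega>. X h \<omega> / c)"
proof -
  have rv[measurable]: "random_variable borel (X t)" if "t \<in> {s + h, s, h, 0}" for t
    using assms that by (intro random_variable) auto
  have "distr M borel (\<lambda>\<omega>. (X (s + h) \<omega> - X s \<omega>) / c)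
      = distr (distr M borel (\<lambda>\<omega>. X (s + h) \<omega> - X s \<omega>)) borel (\<lambda>x. x / c)"
    by (subst distr_distr) (auto simp: comp_def)
  also have "\<dots> = distr M borel (\<lambda>\<omega>. (X h \<omega> - X 0 \<omega>) / c)"
    unfolding stationary_increments[OF assms] by (subst distr_distr) (auto simp: comp_def)
  also have "\<dots> = distr M borel (\<lambda>\<omega>. X h \<omega> / c)"
    using start by (intro distr_cong_AE) auto
  finally show ?thesis .
qed

lemma prob_grid:
  assumes "0 < N" "0 < \<epsilon>"
  shows "prob {\<omega> \<in> space M. \<forall>j\<le>N. \<bar>X (real j / real N) \<omega>\<bar> \<le> \<epsilon>}
    = (kill (distr M borel (\<lambda>\<omega>. X (1 / real N) \<omega> / \<epsilon>)) ^^ N) (indicator {-1..1}) 0"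
proof -
  define \<xi> where "\<xi> i \<omega> = (X (real (Suc i) / real N) \<omega> - X (real i / real N) \<omega>) / \<epsilon>" for i \<omega>
  define \<mu> where "\<mu> = distr M borel (\<lambda>\<omega>. X (1 / real N) \<omega> / \<epsilon>)"
  have rv[measurable]: "random_variable borel (X (real i / real N))" if "i \<le> N" for i
    using that assms by (intro random_variable) auto
  have indep: "indep_vars (\<lambda>_. borel) \<xi> {..<N}"
    unfolding \<xi>_def using assms
    by (intro indep_vars_compose2[where Y = "\<lambda>_ x. x / \<epsilon>" and M' = "\<lambda>_. borel"] independent_increments)
      (auto simp: divide_right_mono)
  have law: "distr M borel (\<xi> i) = \<mu>" if "i < N" for i
    using distr_increment[of "real i / real N" "1 / real N" \<epsilon>] that assms
    by (simp add: \<xi>_def[abs_def] \<mu>_def add_divide_distrib[symmetric] add.commute)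
  have sum: "(\<Sum>i<j. \<xi> i \<omega>) = (X (real j / real N) \<omega> - X 0 \<omega>) / \<epsilon>" for j \<omega>
    by (induction j) (simp_all add: \<xi>_def diff_divide_distrib)
  have "prob {\<omega> \<in> space M. \<forall>j\<le>N. \<bar>X (real j / real N) \<omega>\<bar> \<le> \<epsilon>}
      = expectation (indicator {\<omega> \<in> space M. \<forall>j\<le>N. \<bar>X (real j / real N) \<omega>\<bar> \<le> \<epsilon>})" by simp
  \<comment> \<open>The test function supplies the factor for the final time, which the product
    omits. The integrands agree only almost everywhere, as \<open>X 0\<close> vanishes almost
    surely.\<close>
  also have "\<dots> = expectation (\<lambda>\<omega>. indicator {-1..1} (\<Sum>i<N. \<xi> i \<omega>)
      * (\<Prod>j<N. indicator {-1..1} (\<Sum>i<j. \<xi> i \<omega>)))"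
  proof (rule integral_cong_AE)
    show "AE \<omega> in M. indicator {\<omega> \<in> space M. \<forall>j\<le>N. \<bar>X (real j / real N) \<omega>\<bar> \<le> \<epsilon>} \<omega>
      = indicator {-1..1} (\<Sum>i<N. \<xi> i \<omega>) * (\<Prod>j<N. indicator {-1..1} (\<Sum>i<j. \<xi> i \<omega>) :: real)"
      using start AE_space
    proof eventually_elim
      case (elim \<omega>)
      have "indicator {-1..1} (\<Sum>i<N. \<xi> i \<omega>) * (\<Prod>j<N. indicator {-1..1} (\<Sum>i<j. \<xi> i \<omega>))
          = (\<Prod>j<Suc N. indicator {-1..1} (\<Sum>i<j. \<xi> i \<omega>) :: real)" by simp
      also have "\<dots> = (\<Prod>j<Suc N. if \<bar>X (real j / real N) \<omega>\<bar> \<le> \<epsilon> then 1 else 0)"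
        using elim assms unfolding sum
        by (intro prod.cong) (auto simp: indicator_def abs_le_iff field_simps)
      also have "\<dots> = (if \<forall>j\<le>N. \<bar>X (real j / real N) \<omega>\<bar> \<le> \<epsilon> then 1 else 0)"
        by (auto simp: less_Suc_eq_le simp del: prod.lessThan_Suc intro!: prod.neutral)
      finally show ?case using elim by (simp add: indicator_def)
    qed
  next
    show "(\<lambda>\<omega>. indicator {-1..1} (\<Sum>i<N. \<xi> i \<omega>) * (\<Prod>j<N. indicator {-1..1} (\<Sum>i<j. \<xi> i \<omega>)) :: real) \<in> borel_measurable M"
    proof -
      have "(\<lambda>\<omega>. \<Sum>i<j. \<xi> i \<omega>) \<in> borel_measurable M" if "j \<le> N" for j
        using indep that by (intro borel_measurable_sum) (auto simp: indep_vars_def)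
      then show ?thesis
        by (intro borel_measurable_times borel_measurable_prod
            measurable_compose[OF _ borel_measurable_indicator[of "{-1..1}" borel]]) auto
    qed
  qed measurable
  also have "\<dots> = (kill \<mu> ^^ N) (indicator {-1..1}) 0"
    by (rule expectation_killed_walk[OF indep law])
      (auto intro!: bounded_borelI[of _ 1] simp: indicator_def)
  finally show ?thesis by (simp add: \<mu>_def)
qed

lemma char_scaled:
  assumes "t \<in> {0..1}"
  shows "char (distr M borel (\<lambda>\<omega>. X t \<omega> / \<epsilon>)) u = exp (- (of_real t * levy_exponent \<nu> v b (u / \<epsilon>)))"
proof -
  have [measurable]: "random_variable borel (X t)" using assms by (rule random_variable)
  have "char (distr M borel (\<lambda>\<omega>. X t \<omega> / \<epsilon>)) u = char (distr M borel (X t)) (u / \<epsilon>)"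
    by (simp add: char_def integral_distr)
  then show ?thesis using characteristic_function[OF assms] by simp
qed

end

section \<open>Cadlag paths\<close>

text \<open>Bisection: near each point the one-sided limits bound \<open>f\<close> on either side,
  and bounds on adjacent intervals combine.\<close>

lemma cadlag_on_unit_bounded:
  assumes "cadlag_on_unit f"
  obtains B where "\<And>t. t \<in> {0..1} \<Longrightarrow> \<bar>f t\<bar> \<le> B"
proof -
  have "\<exists>B. \<forall>t\<in>{0..1}. t \<in> {0..1} \<longrightarrow> \<bar>f t\<bar> \<le> B"
  \<comment> \<open>The guard \<open>t \<in> {0..1}\<close> sits inside the property because small
    intervals around 0 or 1 may stick out of the unit interval.\<close>
  proof (rule Bolzano[where P = "\<lambda>a b. \<exists>B. \<forall>t\<in>{a..b}. t \<in> {0..1} \<longrightarrow> \<bar>f t\<bar> \<le> B"])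
    fix a b c :: real
    assume "\<exists>B. \<forall>t\<in>{a..b}. t \<in> {0..1} \<longrightarrow> \<bar>f t\<bar> \<le> B" "\<exists>B. \<forall>t\<in>{b..c}. t \<in> {0..1} \<longrightarrow> \<bar>f t\<bar> \<le> B"
    then obtain B C where B: "\<And>t. t \<in> {a..b} \<Longrightarrow> t \<in> {0..1} \<Longrightarrow> \<bar>f t\<bar> \<le> B"
      and C: "\<And>t. t \<in> {b..c} \<Longrightarrow> t \<in> {0..1} \<Longrightarrow> \<bar>f t\<bar> \<le> C"
      by blast
    show "\<exists>B. \<forall>t\<in>{a..c}. t \<in> {0..1} \<longrightarrow> \<bar>f t\<bar> \<le> B"
    proof (intro exI ballI impI)
      fix t assume "t \<in> {a..c}" "t \<in> {0..1}"
      then show "\<bar>f t\<bar> \<le> max B C" using B[of t] C[of t] by (cases "t \<le> b") auto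
    qed
  next
    fix x :: real assume x: "0 \<le> x" "x \<le> 1"
    have bound: "\<forall>\<^sub>F t in F. \<bar>f t\<bar> \<le> \<bar>l\<bar> + 1" if "(f \<longlongrightarrow> l) F" for l F
      using tendstoD[OF that, of 1] by (auto elim!: eventually_mono simp: dist_real_def)
    have "\<exists>d>0. \<exists>B. \<forall>t\<in>{0..1}. x < t \<and> t < x + d \<longrightarrow> \<bar>f t\<bar> \<le> B"
    proof (cases "x = 1")
      case False
      then have "(f \<longlongrightarrow> f x) (at_right x)"
        using assms x by (auto simp: cadlag_on_unit_def continuous_within)
      from bound[OF this] obtain c where "c > x" "\<And>t. x < t \<Longrightarrow> t < c \<Longrightarrow> \<bar>f t\<bar> \<le> \<bar>f x\<bar> + 1"
        unfolding eventually_at_right_field by auto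
      then show ?thesis by (intro exI[of _ "c - x"]) auto
    qed (auto intro!: exI[of _ 1])
    moreover have "\<exists>d>0. \<exists>B. \<forall>t\<in>{0..1}. x - d < t \<and> t < x \<longrightarrow> \<bar>f t\<bar> \<le> B"
    proof (cases "x = 0")
      case False
      then have "x \<in> {0<..1}" using x by auto
      then obtain l where "(f \<longlongrightarrow> l) (at_left x)"
        using assms unfolding cadlag_on_unit_def by blast
      from bound[OF this] obtain c where "c < x" "\<And>t. c < t \<Longrightarrow> t < x \<Longrightarrow> \<bar>f t\<bar> \<le> \<bar>l\<bar> + 1"
        unfolding eventually_at_left_field by auto
      then show ?thesis by (intro exI[of _ "x - c"]) auto
    qed (auto intro!: exI[of _ 1])
    ultimately obtain d B e C where de: "0 < d" "0 < e"
      and B: "\<And>t. t \<in> {0..1} \<Longrightarrow> x < t \<Longrightarrow> t < x + d \<Longrightarrow> \<bar>f t\<bar> \<le> B"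
      and C: "\<And>t. t \<in> {0..1} \<Longrightarrow> x - e < t \<Longrightarrow> t < x \<Longrightarrow> \<bar>f t\<bar> \<le> C"
      by blast
    show "\<exists>d>0. \<forall>a b. a \<le> x \<and> x \<le> b \<and> b - a < d \<longrightarrow> (\<exists>B. \<forall>t\<in>{a..b}. t \<in> {0..1} \<longrightarrow> \<bar>f t\<bar> \<le> B)"
    proof (rule exI[of _ "min d e"], intro conjI allI impI)
      fix a b assume ab: "a \<le> x \<and> x \<le> b \<and> b - a < min d e"
      show "\<exists>B. \<forall>t\<in>{a..b}. t \<in> {0..1} \<longrightarrow> \<bar>f t\<bar> \<le> B"
      proof (intro exI ballI impI)
        fix t assume t: "t \<in> {a..b}" "t \<in> {0..1}"
        show "\<bar>f t\<bar> \<le> max \<bar>f x\<bar> (max B C)"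
          using ab t B[of t] C[of t] by (cases t x rule: linorder_cases) auto
      qed
    qed (use de in auto)
  qed simp
  then show ?thesis using that by blast
qed

text \<open>Grid points approach \<open>t\<close> from the right, where \<open>f\<close> is
  continuous. The end point 1 is itself on the grid.\<close>

lemma cadlag_on_unit_grid_le:
  assumes f: "cadlag_on_unit f" and n: "0 < n"
    and grid: "\<And>j i. i \<le> n * 2 ^ j \<Longrightarrow> \<bar>f (real i / real (n * 2 ^ j))\<bar> \<le> c" and t: "t \<in> {0..1}"
  shows "\<bar>f t\<bar> \<le> c"
proof (cases "t = 1")
  case True
  then show ?thesis using grid[of n 0] n by simp
next
  case False
  define N where "N j = n * 2 ^ j" for j :: nat
  \<comment> \<open>Adding 1 places the grid point strictly to the right of \<open>t\<close>, even
    when \<open>t\<close> lies on the grid, as \<open>at_right t\<close> demands;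
    \<open>t < 1\<close> keeps the index within \<open>N j\<close>.\<close>
  define i where "i j = nat \<lfloor>t * real (N j)\<rfloor> + 1" for j
  have N: "0 < N j" for j using n by (simp add: N_def)
  have i: "t * real (N j) < real (i j)" "real (i j) \<le> t * real (N j) + 1" for j
  proof -
    have "real (i j) = of_int \<lfloor>t * real (N j)\<rfloor> + 1" using t by (simp add: i_def)
    then show "t * real (N j) < real (i j)" "real (i j) \<le> t * real (N j) + 1" by linarith+
  qed
  have "i j \<le> N j" for j
  proof -
    have "t * real (N j) < real (N j)" using False t N[of j] by simp
    then have "\<lfloor>t * real (N j)\<rfloor> < int (N j)" by (simp add: floor_less_iff)
    then show ?thesis using t by (simp add: i_def Suc_le_eq nat_less_iff)
  qed
  then have le: "\<bar>f (real (i j) / real (N j))\<bar> \<le> c" for j using grid[of "i j" j] by (simp add: N_def)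
  have gt: "t < real (i j) / real (N j)" for j using i(1)[of j] N[of j] by (simp add: field_simps)
  have lim: "(\<lambda>j. real (i j) / real (N j)) \<longlonglongrightarrow> t"
  proof (rule tendsto_sandwich[OF _ _ tendsto_const])
    have "(\<lambda>j. t + (1 / real n) * (1 / 2) ^ j) \<longlonglongrightarrow> t + (1 / real n) * 0"
      by (intro tendsto_intros LIMSEQ_power_zero) simp
    then show "(\<lambda>j. t + (1 / real n) * (1 / 2) ^ j) \<longlonglongrightarrow> t" by simp
    have "real (i j) / real (N j) \<le> t + (1 / real n) * (1 / 2) ^ j" for j
    proof -
      have "real (i j) / real (N j) \<le> (t * real (N j) + 1) / real (N j)"
        using i(2)[of j] by (intro divide_right_mono) auto
      also have "\<dots> = t + (1 / real n) * (1 / 2) ^ j"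
        using N[of j] by (simp add: add_divide_distrib) (simp add: N_def power_one_over field_simps)
      finally show ?thesis .
    qed
    then show "\<forall>\<^sub>F j in sequentially. real (i j) / real (N j) \<le> t + (1 / real n) * (1 / 2) ^ j" by simp
  qed (simp add: gt less_imp_le)
  have "(f \<longlongrightarrow> f t) (at_right t)"
    using f t False by (auto simp: cadlag_on_unit_def continuous_within)
  moreover have "filterlim (\<lambda>j. real (i j) / real (N j)) (at_right t) sequentially"
    using lim gt by (auto simp: filterlim_at less_imp_neq[OF gt, symmetric])
  ultimately have "(\<lambda>j. f (real (i j) / real (N j))) \<longlonglongrightarrow> f t" by (rule filterlim_compose)
  then have "(\<lambda>j. \<bar>f (real (i j) / real (N j))\<bar>) \<longlonglongrightarrow> \<bar>f t\<bar>" by (rule tendsto_rabs)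
  then show ?thesis using le by (intro LIMSEQ_le_const2) auto
qed

section \<open>The sup norm through refining grids\<close>

context levy_process
begin

lemma path_sup_norm_le_iff:
  assumes "\<omega> \<in> space M"
  shows "path_sup_norm X \<omega> \<le> c \<longleftrightarrow> (\<forall>t\<in>{0..1}. \<bar>X t \<omega>\<bar> \<le> c)"
proof -
  obtain B where "\<And>t. t \<in> {0..1} \<Longrightarrow> \<bar>X t \<omega>\<bar> \<le> B"
    using cadlag_on_unit_bounded[OF cadlag_paths[OF assms]] by blast
  then have "bdd_above ((\<lambda>t. \<bar>X t \<omega>\<bar>) ` {0..1})" by (intro bdd_aboveI2[of _ _ B]) auto
  then show ?thesis unfolding path_sup_norm_def by (subst cSUP_le_iff) auto
qed

text \<open>Doubling nests the grids, so the grid events decrease; by right continuity of the paths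
  their intersection is the event for the whole path, and continuity from above applies.\<close>

lemma prob_path_sup_norm_limit:
  assumes n: "0 < n"
  shows "(\<lambda>j. prob {\<omega> \<in> space M. \<forall>i\<le>n * 2 ^ j. \<bar>X (real i / real (n * 2 ^ j)) \<omega>\<bar> \<le> c})
    \<longlonglongrightarrow> prob {\<omega> \<in> space M. path_sup_norm X \<omega> \<le> c}"
    and "prob {\<omega> \<in> space M. path_sup_norm X \<omega> \<le> c}
      \<le> prob {\<omega> \<in> space M. \<forall>i\<le>n. \<bar>X (real i / real n) \<omega>\<bar> \<le> c}"
proof -
  define A where "A j = {\<omega> \<in> space M. \<forall>i\<le>n * 2 ^ j. \<bar>X (real i / real (n * 2 ^ j)) \<omega>\<bar> \<le> c}" for j :: nat
  have A: "A j \<in> events" for j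
  proof -
    have [measurable]: "random_variable borel (X (real i / real (n * 2 ^ j)))" if "i \<le> n * 2 ^ j" for i
    proof -
      have "real i \<le> real (n * 2 ^ j)" using that by (simp only: of_nat_le_iff)
      then show ?thesis by (intro random_variable) (auto simp: divide_le_eq)
    qed
    show ?thesis unfolding A_def by measurable
  qed
  have "A (Suc j) \<subseteq> A j" for j
  proof
    fix \<omega> assume \<omega>: "\<omega> \<in> A (Suc j)"
    show "\<omega> \<in> A j" unfolding A_def
    proof (intro CollectI conjI allI impI)
      fix i assume "i \<le> n * 2 ^ j"
      then have "2 * i \<le> n * 2 ^ Suc j" by simp
      then have "\<bar>X (real (2 * i) / real (n * 2 ^ Suc j)) \<omega>\<bar> \<le> c" using \<omega> unfolding A_def by blast
      then show "\<bar>X (real i / real (n * 2 ^ j)) \<omega>\<bar> \<le> c" by simp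
    qed (use \<omega> in \<open>auto simp: A_def\<close>)
  qed
  then have "decseq A" by (rule decseq_SucI)
  then have "(\<lambda>j. prob (A j)) \<longlonglongrightarrow> prob (\<Inter>j. A j)" by (intro finite_Lim_measure_decseq) (use A in auto)
  moreover have Int: "(\<Inter>j. A j) = {\<omega> \<in> space M. path_sup_norm X \<omega> \<le> c}"
  proof (intro set_eqI iffI)
    fix \<omega> assume \<omega>: "\<omega> \<in> (\<Inter>j. A j)"
    then have "\<omega> \<in> space M" by (auto simp: A_def)
    moreover have grid: "\<bar>X (real i / real (n * 2 ^ j)) \<omega>\<bar> \<le> c" if "i \<le> n * 2 ^ j" for i j
      using \<omega> that unfolding A_def by blast
    moreover have "\<forall>t\<in>{0..1}. \<bar>X t \<omega>\<bar> \<le> c"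
      by (intro ballI cadlag_on_unit_grid_le[OF cadlag_paths[OF \<open>\<omega> \<in> space M\<close>] n grid])
    ultimately show "\<omega> \<in> {\<omega> \<in> space M. path_sup_norm X \<omega> \<le> c}" by (simp add: path_sup_norm_le_iff)
  next
    fix \<omega> assume \<omega>: "\<omega> \<in> {\<omega> \<in> space M. path_sup_norm X \<omega> \<le> c}"
    have "real i / real (n * 2 ^ j) \<in> {0..1}" if "i \<le> n * 2 ^ j" for i j
    proof -
      have "real i \<le> real (n * 2 ^ j)" using that by (simp only: of_nat_le_iff)
      then show ?thesis by (auto simp: divide_le_eq)
    qed
    moreover have "\<omega> \<in> space M" "\<forall>t\<in>{0..1}. \<bar>X t \<omega>\<bar> \<le> c"
      using \<omega> path_sup_norm_le_iff[of \<omega> c] by auto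
    ultimately show "\<omega> \<in> (\<Inter>j. A j)" unfolding A_def by blast
  qed
  ultimately show "(\<lambda>j. prob {\<omega> \<in> space M. \<forall>i\<le>n * 2 ^ j. \<bar>X (real i / real (n * 2 ^ j)) \<omega>\<bar> \<le> c})
    \<longlonglongrightarrow> prob {\<omega> \<in> space M. path_sup_norm X \<omega> \<le> c}" by (simp add: A_def)
  have "prob (\<Inter>j. A j) \<le> prob (A 0)" by (intro finite_measure_mono A) auto
  then show "prob {\<omega> \<in> space M. path_sup_norm X \<omega> \<le> c}
      \<le> prob {\<omega> \<in> space M. \<forall>i\<le>n. \<bar>X (real i / real n) \<omega>\<bar> \<le> c}"
    unfolding Int by (simp add: A_def)
qed

end

section \<open>Small balls\<close>

lemma ex_grid_size:
  fixes h \<epsilon> :: real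
  assumes "0 < h" "0 < \<epsilon>"
  obtains n :: nat where "0 < n" "1 / (real n * \<epsilon>\<^sup>2) \<le> h"
proof -
  obtain n :: nat where n: "1 / (h * \<epsilon>\<^sup>2) < real n" using reals_Archimedean2 by blast
  have "0 < 1 / (h * \<epsilon>\<^sup>2)" using assms by simp
  with n have "0 < n" by (metis less_trans of_nat_0_less_iff)
  with n assms show ?thesis by (intro that[of n]) (auto simp: field_simps less_imp_le)
qed

context levy_process
begin

text \<open>Measuring space in units of \<epsilon> and time in units of \<epsilon>^2 turns the time
  step into \<open>1 / (real N * \<epsilon>\<^sup>2)\<close> and the exponent into the one
  controlled by \<open>levy_exponent_scaling\<close>.\<close>

lemma char_grid_step:
  assumes "0 < N" "0 < \<epsilon>"
  shows "real_distribution (distr M borel (\<lambda>\<omega>. X (1 / real N) \<omega> / \<epsilon>))"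
    and "char (distr M borel (\<lambda>\<omega>. X (1 / real N) \<omega> / \<epsilon>)) u
      = exp (- (of_real (1 / (real N * \<epsilon>\<^sup>2)) * (of_real (\<epsilon>\<^sup>2) * levy_exponent \<nu> v b (u / \<epsilon>))))"
proof -
  have N: "1 / real N \<in> {0..1}" using assms by (auto simp: field_simps)
  from random_variable[OF this] have [measurable]: "random_variable borel (X (1 / real N))" .
  show "real_distribution (distr M borel (\<lambda>\<omega>. X (1 / real N) \<omega> / \<epsilon>))"
    by (intro real_distribution_distr) measurable
  have "of_real (1 / (real N * \<epsilon>\<^sup>2)) * (of_real (\<epsilon>\<^sup>2) * z) = of_real (1 / real N) * z" for z :: complex
    using assms by simp
  then show "char (distr M borel (\<lambda>\<omega>. X (1 / real N) \<omega> / \<epsilon>)) u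
      = exp (- (of_real (1 / (real N * \<epsilon>\<^sup>2)) * (of_real (\<epsilon>\<^sup>2) * levy_exponent \<nu> v b (u / \<epsilon>))))"
    by (simp only: char_scaled[OF N])
qed

text \<open>For given \<epsilon> the coarse grid of \<open>n\<close> intervals is fixed and each
  interval is split into \<open>2 ^ j\<close> steps. The bound for the walk does not depend on
  \<open>j\<close>, so it passes to the limit.\<close>

lemma small_ball_lower:
  assumes v: "0 < v" and a: "pi / 2 < a" "a \<le> pi"
  shows "\<forall>\<^sub>F \<epsilon> in at_right 0.
    exp (- (v / 2 * a\<^sup>2 / \<epsilon>\<^sup>2)) \<le> prob {\<omega> \<in> space M. path_sup_norm X \<omega> \<le> \<epsilon>}"
proof -
  obtain V \<theta> h where V: "0 < V" "0 < \<theta>" "0 < h"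
    and walk: "\<And>M \<psi> s m n. real_distribution M \<Longrightarrow> 0 \<le> s \<Longrightarrow> (\<And>u. char M u = exp (- (of_real s * \<psi> u))) \<Longrightarrow>
      (\<And>u. 0 \<le> u \<Longrightarrow> u \<le> V \<Longrightarrow> cmod (\<psi> u - of_real (v / 2 * u\<^sup>2)) \<le> \<theta>) \<Longrightarrow> real m * s \<le> h \<Longrightarrow>
      exp (- (real m * s * (v / 2 * a\<^sup>2))) ^ n \<le> (kill M ^^ (n * m)) (indicator {-1..1}) 0"
    using kill_pow_lower_exponent[OF a v] by metis
  have "\<forall>\<^sub>F \<epsilon>::real in at_right 0. 0 < \<epsilon>" by (rule eventually_at_right_less)
  with levy_exponent_scaling[OF levy_measure less_imp_le[OF V(1)] V(2), of v b]
  show ?thesis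
  proof eventually_elim
    case (elim \<epsilon>)
    obtain n where n: "0 < n" "1 / (real n * \<epsilon>\<^sup>2) \<le> h" using ex_grid_size[OF V(3) elim(2)] .
    have "exp (- (v / 2 * a\<^sup>2 / \<epsilon>\<^sup>2))
        \<le> prob {\<omega> \<in> space M. \<forall>i\<le>n * 2 ^ j. \<bar>X (real i / real (n * 2 ^ j)) \<omega>\<bar> \<le> \<epsilon>}" for j
    proof -
      define m N where "m = (2::nat) ^ j" and "N = n * m"
      define s where "s = 1 / (real N * \<epsilon>\<^sup>2)"
      have N: "0 < N" using n by (simp add: N_def m_def)
      have ms: "real m * s = 1 / (real n * \<epsilon>\<^sup>2)" by (simp add: s_def N_def m_def)
      have "exp (- (v / 2 * a\<^sup>2 / \<epsilon>\<^sup>2)) = exp (- (real m * s * (v / 2 * a\<^sup>2))) ^ n"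
        unfolding ms using n by (simp add: exp_of_nat_mult[symmetric])
      also have "\<dots> \<le> (kill (distr M borel (\<lambda>\<omega>. X (1 / real N) \<omega> / \<epsilon>)) ^^ (n * m)) (indicator {-1..1}) 0"
      proof (rule walk)
        show "char (distr M borel (\<lambda>\<omega>. X (1 / real N) \<omega> / \<epsilon>)) u
            = exp (- (of_real s * (of_real (\<epsilon>\<^sup>2) * levy_exponent \<nu> v b (u / \<epsilon>))))" for u
          unfolding s_def by (rule char_grid_step(2)[OF N elim(2)])
        show "real m * s \<le> h" unfolding ms by (rule n(2))
      qed (use elim char_grid_step(1)[OF N elim(2)] in \<open>auto simp: s_def\<close>)
      also have "\<dots> = prob {\<omega> \<in> space M. \<forall>i\<le>N. \<bar>X (real i / real N) \<omega>\<bar> \<le> \<epsilon>}"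
        unfolding N_def[symmetric] by (rule prob_grid[OF N elim(2), symmetric])
      finally show ?thesis by (simp only: N_def m_def)
    qed
    then show ?case by (intro LIMSEQ_le_const[OF prob_path_sup_norm_limit(1)[OF n(1)]]) auto
  qed
qed

text \<open>A single grid with small enough step suffices, since testing the path only on a grid
  enlarges the event.\<close>

lemma small_ball_upper:
  assumes v: "0 < v" and a: "0 < a'" "a' < a" "a < pi / 2"
  shows "\<forall>\<^sub>F \<epsilon> in at_right 0.
    prob {\<omega> \<in> space M. path_sup_norm X \<omega> \<le> \<epsilon>} \<le> exp (- (v / 2 * a'\<^sup>2 / \<epsilon>\<^sup>2)) / cos a"
proof -
  obtain V \<theta> h where V: "0 < V" "0 < \<theta>" "0 < h"
    and walk: "\<And>M \<psi> s n. real_distribution M \<Longrightarrow> 0 \<le> s \<Longrightarrow> (\<And>u. char M u = exp (- (of_real s * \<psi> u))) \<Longrightarrow>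
      (\<And>u. 0 \<le> u \<Longrightarrow> u \<le> V \<Longrightarrow> cmod (\<psi> u - of_real (v / 2 * u\<^sup>2)) \<le> \<theta>) \<Longrightarrow> s \<le> h \<Longrightarrow>
      (kill M ^^ n) (indicator {-1..1}) 0 \<le> exp (- (s * (v / 2 * a'\<^sup>2))) ^ n / cos a"
    using kill_pow_upper_exponent[OF a v] by metis
  have "\<forall>\<^sub>F \<epsilon>::real in at_right 0. 0 < \<epsilon>" by (rule eventually_at_right_less)
  with levy_exponent_scaling[OF levy_measure less_imp_le[OF V(1)] V(2), of v b]
  show ?thesis
  proof eventually_elim
    case (elim \<epsilon>)
    obtain n where n: "0 < n" "1 / (real n * \<epsilon>\<^sup>2) \<le> h" using ex_grid_size[OF V(3) elim(2)] .
    define s where "s = 1 / (real n * \<epsilon>\<^sup>2)"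
    have "prob {\<omega> \<in> space M. path_sup_norm X \<omega> \<le> \<epsilon>}
        \<le> prob {\<omega> \<in> space M. \<forall>i\<le>n. \<bar>X (real i / real n) \<omega>\<bar> \<le> \<epsilon>}"
      by (rule prob_path_sup_norm_limit(2)[OF n(1)])
    also have "\<dots> = (kill (distr M borel (\<lambda>\<omega>. X (1 / real n) \<omega> / \<epsilon>)) ^^ n) (indicator {-1..1}) 0"
      by (rule prob_grid[OF n(1) elim(2)])
    also have "\<dots> \<le> exp (- (s * (v / 2 * a'\<^sup>2))) ^ n / cos a"
    proof (rule walk)
      show "char (distr M borel (\<lambda>\<omega>. X (1 / real n) \<omega> / \<epsilon>)) u
          = exp (- (of_real s * (of_real (\<epsilon>\<^sup>2) * levy_exponent \<nu> v b (u / \<epsilon>))))" for u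
        unfolding s_def by (rule char_grid_step(2)[OF n(1) elim(2)])
      show "s \<le> h" unfolding s_def by (rule n(2))
    qed (use elim char_grid_step(1)[OF n(1) elim(2)] in \<open>auto simp: s_def\<close>)
    also have "exp (- (s * (v / 2 * a'\<^sup>2))) ^ n = exp (- (v / 2 * a'\<^sup>2 / \<epsilon>\<^sup>2))"
      using n by (simp add: s_def exp_of_nat_mult[symmetric])
    finally show ?case .
  qed
qed

text \<open>At frequency \<open>pi / 2 * k\<close> the rate in the two small ball bounds is
  \<open>k\<^sup>2\<close> times the asserted one, and \<open>k\<close> may be taken as close to 1
  as desired, from above and from below.\<close>

lemma small_ball_asymptotics:
  assumes v: "0 < v"
  shows "((\<lambda>\<epsilon>. - ln (prob {\<omega> \<in> space M. path_sup_norm X \<omega> \<le> \<epsilon>}) / (pi\<^sup>2 / 8 * v / \<epsilon>\<^sup>2))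
    \<longlongrightarrow> 1) (at_right 0)"
proof (rule order_tendstoI)
  define P where "P \<epsilon> = prob {\<omega> \<in> space M. path_sup_norm X \<omega> \<le> \<epsilon>}" for \<epsilon>
  have pos: "\<forall>\<^sub>F \<epsilon>::real in at_right 0. 0 < \<epsilon>" by (rule eventually_at_right_less)
  have rate: "v / 2 * (pi / 2 * k)\<^sup>2 / \<epsilon>\<^sup>2 = k\<^sup>2 * (pi\<^sup>2 / 8 * v / \<epsilon>\<^sup>2)" for k \<epsilon> :: real
    by (simp add: power_mult_distrib power_divide)
  {
    fix c :: real assume c: "1 < c"
    \<comment> \<open>For \<open>x \<le> 1\<close> the square of 1 + x is at most 1 + 3 x, which is
      below \<open>c\<close>; the same restriction keeps the frequency at most
      \<open>pi\<close>.\<close>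
    define x where "x = min 1 ((c - 1) / 4)"
    have x: "0 < x" "x \<le> 1" "4 * x \<le> c - 1" using c by (auto simp: x_def min_def)
    have "x\<^sup>2 \<le> x * 1" unfolding power2_eq_square using x by (intro mult_left_mono) auto
    then have kc: "(1 + x)\<^sup>2 < c" using x by (simp add: power2_sum)
    have "pi / 2 < pi / 2 * (1 + x)" "pi / 2 * (1 + x) \<le> pi" using x by auto
    from small_ball_lower[OF v this] pos
    show "\<forall>\<^sub>F \<epsilon> in at_right 0. - ln (prob {\<omega> \<in> space M. path_sup_norm X \<omega> \<le> \<epsilon>}) / (pi\<^sup>2 / 8 * v / \<epsilon>\<^sup>2) < c"
      unfolding P_def[symmetric]
    proof eventually_elim
      case (elim \<epsilon>)
      define g where "g = pi\<^sup>2 / 8 * v / \<epsilon>\<^sup>2"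
      have g: "0 < g" using v elim by (simp add: g_def)
      have "exp (- ((1 + x)\<^sup>2 * g)) \<le> P \<epsilon>" using elim(1) unfolding rate g_def .
      then have "- ((1 + x)\<^sup>2 * g) \<le> ln (P \<epsilon>)"
        using ln_mono[of "exp (- ((1 + x)\<^sup>2 * g))" "P \<epsilon>"] less_le_trans[OF exp_gt_zero] by simp
      then have "- ln (P \<epsilon>) / g \<le> ((1 + x)\<^sup>2 * g) / g" using g by (intro divide_right_mono) auto
      then have "- ln (P \<epsilon>) / g \<le> (1 + x)\<^sup>2" using g by simp
      then show ?case using kc unfolding g_def by linarith
    qed
  }
  {
    fix c :: real assume c: "c < 1"
    define x where "x = min (1 / 2) ((1 - c) / 4)"
    have x: "0 < x" "x \<le> 1 / 2" "4 * x \<le> 1 - c" using c by (auto simp: x_def min_def)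
    have kc: "c < (1 - x)\<^sup>2"
    proof -
      have "(1 - x)\<^sup>2 = 1 + x\<^sup>2 - 2 * x" by (simp add: power2_diff)
      then show ?thesis using x zero_le_power2[of x] by linarith
    qed
    \<comment> \<open>Halfway between \<open>pi / 2 * (1 - x)\<close> and \<open>pi / 2\<close>, as
      \<open>small_ball_upper\<close> needs two distinct frequencies below
      \<open>pi / 2\<close>.\<close>
    define a where "a = pi / 2 * (1 - x / 2)"
    have a: "0 < pi / 2 * (1 - x)" "pi / 2 * (1 - x) < a" "a < pi / 2"
      using x by (auto simp: a_def)
    have ca: "0 < cos a" using a by (intro cos_gt_zero) auto
    \<comment> \<open>The constant factor \<open>1 / cos a\<close> of the upper bound contributes
      only a term of order \<epsilon>^2 to the quotient.\<close>
    have "((\<lambda>\<epsilon>. ln (cos a) * \<epsilon>\<^sup>2 / (pi\<^sup>2 / 8 * v)) \<longlongrightarrow> ln (cos a) * 0\<^sup>2 / (pi\<^sup>2 / 8 * v)) (at_right 0)"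
      using v by (intro tendsto_intros) auto
    then have "\<forall>\<^sub>F \<epsilon> in at_right 0. c - (1 - x)\<^sup>2 < ln (cos a) * \<epsilon>\<^sup>2 / (pi\<^sup>2 / 8 * v)"
      using kc by (intro order_tendstoD) auto
    \<comment> \<open>Monotonicity of \<open>ln\<close> requires a positive probability, which the
      lower bound at frequency \<open>pi\<close> provides.\<close>
    moreover have "\<forall>\<^sub>F \<epsilon> in at_right 0. 0 < P \<epsilon>"
    proof -
      have "pi / 2 < pi" by simp
      from small_ball_lower[OF v this order.refl] show ?thesis
        unfolding P_def by eventually_elim (rule less_le_trans[OF exp_gt_zero])
    qed
    ultimately show "\<forall>\<^sub>F \<epsilon> in at_right 0. c < - ln (prob {\<omega> \<in> space M. path_sup_norm X \<omega> \<le> \<epsilon>}) / (pi\<^sup>2 / 8 * v / \<epsilon>\<^sup>2)"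
      using small_ball_upper[OF v a] pos unfolding P_def[symmetric]
    proof eventually_elim
      case (elim \<epsilon>)
      define g where "g = pi\<^sup>2 / 8 * v / \<epsilon>\<^sup>2"
      have g: "0 < g" using v elim by (simp add: g_def)
      have "P \<epsilon> \<le> exp (- ((1 - x)\<^sup>2 * g)) / cos a" using elim(3) unfolding rate g_def .
      then have "ln (P \<epsilon>) \<le> ln (exp (- ((1 - x)\<^sup>2 * g)) / cos a)"
        using elim(2) ca by (subst ln_le_cancel_iff) auto
      also have "\<dots> = - ((1 - x)\<^sup>2 * g) - ln (cos a)" using ca by (simp add: ln_div)
      finally have "(1 - x)\<^sup>2 * g + ln (cos a) \<le> - ln (P \<epsilon>)" by simp
      then have "((1 - x)\<^sup>2 * g + ln (cos a)) / g \<le> - ln (P \<epsilon>) / g"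
        using g by (intro divide_right_mono) auto
      moreover have "((1 - x)\<^sup>2 * g + ln (cos a)) / g = (1 - x)\<^sup>2 + ln (cos a) * \<epsilon>\<^sup>2 / (pi\<^sup>2 / 8 * v)"
        using g by (simp add: add_divide_distrib) (simp add: g_def)
      ultimately show ?case using elim(1) unfolding g_def by linarith
    qed
  }
qed

end

theorem corollary2p6:
  fixes M :: "'a measure" and X :: "real \<Rightarrow> 'a \<Rightarrow> real"
    and \<nu> :: "real measure" and \<sigma> b :: real
  assumes "levy_process M X \<nu> (\<sigma>\<^sup>2) b"
    and "\<sigma> \<noteq> 0"
  shows "(\<lambda>\<epsilon>. - ln (measure M {\<omega> \<in> space M. path_sup_norm X \<omega> \<le> \<epsilon>}))
           \<sim>[at_right 0] (\<lambda>\<epsilon>. pi\<^sup>2 / 8 * \<sigma>\<^sup>2 / \<epsilon>\<^sup>2)"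
proof -
  interpret levy_process M X \<nu> "\<sigma>\<^sup>2" b by fact
  show ?thesis using assms(2) by (intro asymp_equivI' small_ball_asymptotics) simp
qed

end
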